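(* Let $K$ be a field and let $E$ be a graph. Then $L_K(E)$ is purely infinite simple if and only if (1) the only hereditary and saturated subsets of $E^0$ are $\emptyset$ and $E^0$, (2) $E$ contains at least one closed path, and (3) $E$ satisfies Condition (L).
   Context: A graph $E=(E^0,E^1,r,s)$ consists of a countable set of vertices $E^0$, a countable set of edges $E^1$, and range and source maps $r,s:E^1\to E^0$. A vertex $v$ is a finite emitter if $0<|s^{-1}(v)|<\infty$. A path of length $n\ge 1$ is $\alpha=e_1\ldots e_n$ with $e_i\in E^1$ and $r(e_i)=s(e_{i+1})$ for $1\le i<n$; $s(\alpha)=s(e_1)$, $r(\alpha)=r(e_n)$. A closed path is a path $\alpha$ of positive length with $s(\alpha)=r(\alpha)$; it is a simple closed path if in addition $s(e_i)\neq s(e_j)$ for $i\ne j$. A closed path $\alpha=e_1\ldots e_n$ has an exit if for some $i$ there is an edge $f\in s^{-1}(s(e_i))\setminus\{e_i\}$. Condition (L): every simple closed path has an exit. A subset $X\subseteq E^0$ is hereditary if $e\in E^1$, $s(e)\in X$ imply $r(e)\in X$; it is saturated if every finite emitter $v$ with $r(s^{-1}(v))\subseteq X$ lies in $X$. A Leavitt $E$-family in a ring is a set $\{v,e,e^*:v\in E^0,e\in E^1\}$ such that the $v$'s are pairwise orthogonal idempotents and: $s(e)e=er(e)=e$ and $r(e)e^*=e^*s(e)=e^*$ for all $e\in E^1$; $e^*f=\delta_{e,f}r(e)$ for all $e,f\in E^1$; $v=\sum_{s(e)=v}ee^*$ whenever $0<|s^{-1}(v)|<\infty$. The Leavitt path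 algebra $L_K(E)$ is the universal $K$-algebra generated by a Leavitt $E$-family. An idempotent $a$ in a ring $R$ is infinite if $aR$ is isomorphic as a right $R$-module to a proper direct summand of itself. $R$ is purely infinite if every nonzero right ideal of $R$ contains an infinite idempotent. Purely infinite simple means purely infinite and simple. *)

theory Defs
  imports
    "HOL-Library.Countable_Set"
    "HOL-Algebra.AbelCoset"
    "HOL-Algebra.Module"
    "Graph_Theory.Arc_Walk"
begin

section \<open>Graphs\<close>

text \<open>
  A graph is a \<^locale>\<open>wf_digraph\<close> with countably many vertices and arcs; loops and parallel
  arcs are allowed. The source map is \<^const>\<open>tail\<close>, the range map is \<^const>\<open>head\<close>, and
  \<^term>\<open>out_arcs E v\<close> is the set of all arcs with source \<^term>\<open>v\<close>. A path is an
  \<^const>\<open>pre_digraph.awalk\<close> of positive length, and the predicate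
  \<^const>\<open>wf_digraph.closed_w\<close> characterises the closed paths, which may revisit vertices.
\<close>

definition finite_emitter :: "('v,'e) pre_digraph \<Rightarrow> 'v \<Rightarrow> bool" where
  "finite_emitter E v \<longleftrightarrow> v \<in> verts E \<and> out_arcs E v \<noteq> {} \<and> finite (out_arcs E v)"

definition hereditary :: "('v,'e) pre_digraph \<Rightarrow> 'v set \<Rightarrow> bool" where
  "hereditary E X \<longleftrightarrow> (\<forall>e\<in>arcs E. tail E e \<in> X \<longrightarrow> head E e \<in> X)"

definition saturated :: "('v,'e) pre_digraph \<Rightarrow> 'v set \<Rightarrow> bool" where
  "saturated E X \<longleftrightarrow> (\<forall>v. finite_emitter E v \<longrightarrow> head E ` out_arcs E v \<subseteq> X \<longrightarrow> v \<in> X)"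

definition simple_closed_path :: "('v,'e) pre_digraph \<Rightarrow> 'e list \<Rightarrow> bool" where
  "simple_closed_path E p \<longleftrightarrow> wf_digraph.closed_w E p \<and> distinct (map (tail E) p)"

definition has_exit :: "('v,'e) pre_digraph \<Rightarrow> 'e list \<Rightarrow> bool" where
  "has_exit E p \<longleftrightarrow> (\<exists>e\<in>set p. \<exists>f\<in>out_arcs E (tail E e). f \<noteq> e)"

definition condition_L :: "('v,'e) pre_digraph \<Rightarrow> bool" where
  "condition_L E \<longleftrightarrow> (\<forall>p. simple_closed_path E p \<longrightarrow> has_exit E p)"


section \<open>Algebras without unit\<close>

text \<open>
  Rings and algebras need not have a unit, so \<^locale>\<open>ring\<close> and the notions based on it do not
  apply. The record types of HOL-Algebra are reused, but the field \<^const>\<open>one\<close> is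
  never referred to.
\<close>

locale nonunital_ring = abelian_group R for R (structure) +
  assumes m_closed: "\<lbrakk>x \<in> carrier R; y \<in> carrier R\<rbrakk> \<Longrightarrow> x \<otimes> y \<in> carrier R"
    and m_assoc: "\<lbrakk>x \<in> carrier R; y \<in> carrier R; z \<in> carrier R\<rbrakk>
      \<Longrightarrow> (x \<otimes> y) \<otimes> z = x \<otimes> (y \<otimes> z)"
    and l_distr: "\<lbrakk>x \<in> carrier R; y \<in> carrier R; z \<in> carrier R\<rbrakk>
      \<Longrightarrow> (x \<oplus> y) \<otimes> z = x \<otimes> z \<oplus> y \<otimes> z"
    and r_distr: "\<lbrakk>x \<in> carrier R; y \<in> carrier R; z \<in> carrier R\<rbrakk>
      \<Longrightarrow> z \<otimes> (x \<oplus> y) = z \<otimes> x \<oplus> z \<otimes> y"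

locale nonunital_algebra = nonunital_ring R
  for R :: "('k::field,'a,'m) module_scheme" (structure) +
  assumes smult_closed: "x \<in> carrier R \<Longrightarrow> c \<odot> x \<in> carrier R"
    and smult_l_distr: "x \<in> carrier R \<Longrightarrow> (c + d) \<odot> x = c \<odot> x \<oplus> d \<odot> x"
    and smult_r_distr: "\<lbrakk>x \<in> carrier R; y \<in> carrier R\<rbrakk> \<Longrightarrow> c \<odot> (x \<oplus> y) = c \<odot> x \<oplus> c \<odot> y"
    and smult_assoc: "x \<in> carrier R \<Longrightarrow> (c * d) \<odot> x = c \<odot> (d \<odot> x)"
    and smult_one: "x \<in> carrier R \<Longrightarrow> 1 \<odot> x = x"
    and smult_mult_l: "\<lbrakk>x \<in> carrier R; y \<in> carrier R\<rbrakk> \<Longrightarrow> c \<odot> (x \<otimes> y) = (c \<odot> x) \<otimes> y"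
    and smult_mult_r: "\<lbrakk>x \<in> carrier R; y \<in> carrier R\<rbrakk> \<Longrightarrow> c \<odot> (x \<otimes> y) = x \<otimes> (c \<odot> y)"

definition algebra_hom ::
  "('k,'a,'m) module_scheme \<Rightarrow> ('k,'b,'n) module_scheme \<Rightarrow> ('a \<Rightarrow> 'b) set" where
  "algebra_hom R S = {f. (\<forall>x\<in>carrier R. f x \<in> carrier S) \<and>
     (\<forall>x\<in>carrier R. \<forall>y\<in>carrier R. f (x \<oplus>\<^bsub>R\<^esub> y) = f x \<oplus>\<^bsub>S\<^esub> f y) \<and>
     (\<forall>x\<in>carrier R. \<forall>y\<in>carrier R. f (x \<otimes>\<^bsub>R\<^esub> y) = f x \<otimes>\<^bsub>S\<^esub> f y) \<and>
     (\<forall>c. \<forall>x\<in>carrier R. f (c \<odot>\<^bsub>R\<^esub> x) = c \<odot>\<^bsub>S\<^esub> f x)}"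


section \<open>Purely infinite simple rings\<close>

definition right_ideal :: "('a,'m) ring_scheme \<Rightarrow> 'a set \<Rightarrow> bool" where
  "right_ideal R I \<longleftrightarrow> additive_subgroup I R \<and> (\<forall>a\<in>I. \<forall>x\<in>carrier R. a \<otimes>\<^bsub>R\<^esub> x \<in> I)"

definition two_sided_ideal :: "('a,'m) ring_scheme \<Rightarrow> 'a set \<Rightarrow> bool" where
  "two_sided_ideal R I \<longleftrightarrow> right_ideal R I \<and> (\<forall>a\<in>I. \<forall>x\<in>carrier R. x \<otimes>\<^bsub>R\<^esub> a \<in> I)"

text \<open>For a ring without unit, simplicity includes the condition that the product is not
  identically zero.\<close>

definition simple_ring :: "('a,'m) ring_scheme \<Rightarrow> bool" where
  "simple_ring R \<longleftrightarrow> (\<exists>x\<in>carrier R. \<exists>y\<in>carrier R. x \<otimes>\<^bsub>R\<^esub> y \<noteq> \<zero>\<^bsub>R\<^esub>) \<and>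
     (\<forall>I. two_sided_ideal R I \<longrightarrow> I = {\<zero>\<^bsub>R\<^esub>} \<or> I = carrier R)"

definition principal_right :: "('a,'m) ring_scheme \<Rightarrow> 'a \<Rightarrow> 'a set" where
  "principal_right R a = {a \<otimes>\<^bsub>R\<^esub> x | x. x \<in> carrier R}"

text \<open>The right modules in question are right ideals, with the operations inherited from the
  ring; the submodules of such a module \<^term>\<open>M\<close> are the right ideals contained in
  \<^term>\<open>M\<close>.\<close>

definition right_module_iso :: "('a,'m) ring_scheme \<Rightarrow> 'a set \<Rightarrow> 'a set \<Rightarrow> ('a \<Rightarrow> 'a) \<Rightarrow> bool" where
  "right_module_iso R M N f \<longleftrightarrow> bij_betw f M N \<and>
     (\<forall>x\<in>M. \<forall>y\<in>M. f (x \<oplus>\<^bsub>R\<^esub> y) = f x \<oplus>\<^bsub>R\<^esub> f y) \<and>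
     (\<forall>x\<in>M. \<forall>r\<in>carrier R. f (x \<otimes>\<^bsub>R\<^esub> r) = f x \<otimes>\<^bsub>R\<^esub> r)"

definition direct_summand :: "('a,'m) ring_scheme \<Rightarrow> 'a set \<Rightarrow> 'a set \<Rightarrow> bool" where
  "direct_summand R N M \<longleftrightarrow> right_ideal R N \<and>
     (\<exists>P. right_ideal R P \<and> N <+>\<^bsub>R\<^esub> P = M \<and> N \<inter> P = {\<zero>\<^bsub>R\<^esub>})"

definition infinite_idempotent :: "('a,'m) ring_scheme \<Rightarrow> 'a \<Rightarrow> bool" where
  "infinite_idempotent R a \<longleftrightarrow> a \<in> carrier R \<and> a \<otimes>\<^bsub>R\<^esub> a = a \<and>
     (\<exists>N f. direct_summand R N (principal_right R a) \<and> N \<noteq> principal_right R a \<and>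
        right_module_iso R (principal_right R a) N f)"

definition purely_infinite :: "('a,'m) ring_scheme \<Rightarrow> bool" where
  "purely_infinite R \<longleftrightarrow>
     (\<forall>I. right_ideal R I \<and> I \<noteq> {\<zero>\<^bsub>R\<^esub>} \<longrightarrow> (\<exists>a\<in>I. infinite_idempotent R a))"

definition purely_infinite_simple :: "('a,'m) ring_scheme \<Rightarrow> bool" where
  "purely_infinite_simple R \<longleftrightarrow> purely_infinite R \<and> simple_ring R"


section \<open>Leavitt path algebras\<close>

definition leavitt_family ::
  "('v,'e) pre_digraph \<Rightarrow> ('a,'m) ring_scheme \<Rightarrow> ('v \<Rightarrow> 'a) \<Rightarrow> ('e \<Rightarrow> 'a) \<Rightarrow> ('e \<Rightarrow> 'a) \<Rightarrow> bool" where
  "leavitt_family E R P X Y \<longleftrightarrow>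
     (\<forall>v\<in>verts E. P v \<in> carrier R) \<and> (\<forall>e\<in>arcs E. X e \<in> carrier R \<and> Y e \<in> carrier R) \<and>
     (\<forall>v\<in>verts E. \<forall>w\<in>verts E. P v \<otimes>\<^bsub>R\<^esub> P w = (if v = w then P v else \<zero>\<^bsub>R\<^esub>)) \<and>
     (\<forall>e\<in>arcs E. P (tail E e) \<otimes>\<^bsub>R\<^esub> X e = X e \<and> X e \<otimes>\<^bsub>R\<^esub> P (head E e) = X e \<and>
        P (head E e) \<otimes>\<^bsub>R\<^esub> Y e = Y e \<and> Y e \<otimes>\<^bsub>R\<^esub> P (tail E e) = Y e) \<and>
     (\<forall>e\<in>arcs E. \<forall>f\<in>arcs E. Y e \<otimes>\<^bsub>R\<^esub> X f = (if e = f then P (head E e) else \<zero>\<^bsub>R\<^esub>)) \<and>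
     (\<forall>v. finite_emitter E v \<longrightarrow> P v = (\<Oplus>\<^bsub>R\<^esub>e\<in>out_arcs E v. X e \<otimes>\<^bsub>R\<^esub> Y e))"

text \<open>
  The universal algebra is constructed by generators and relations: the terms in the signature of
  \<^typ>\<open>'k\<close>-algebras over the symbols $v$, $e$, $e^*$, modulo the least congruence that contains the
  axioms of an associative (non-unital) \<^typ>\<open>'k\<close>-algebra and the relations of a Leavitt family.
  As the symbols are indexed by whole types, those not belonging to the graph
  are equated to zero, which is the same as omitting them.
\<close>

datatype ('k,'v,'e) leavitt_term =
    Vertex 'v
  | Edge 'e
  | Ghost 'e
  | Zero
  | Neg "('k,'v,'e) leavitt_term"
  | Add "('k,'v,'e) leavitt_term" "('k,'v,'e) leavitt_term"
  | Mult "('k,'v,'e) leavitt_term" "('k,'v,'e) leavitt_term"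
  | Scale 'k "('k,'v,'e) leavitt_term"

text \<open>In rule \<open>emitter\<close> the list \<open>es\<close> enumerates the arcs leaving \<open>v\<close> without repetition.\<close>

inductive leavitt_eq ::
  "('v,'e) pre_digraph \<Rightarrow> ('k::field,'v,'e) leavitt_term \<Rightarrow> ('k,'v,'e) leavitt_term \<Rightarrow> bool"
  for E :: "('v,'e) pre_digraph" where
  refl: "leavitt_eq E x x"
| sym: "leavitt_eq E x y \<Longrightarrow> leavitt_eq E y x"
| trans: "leavitt_eq E x y \<Longrightarrow> leavitt_eq E y z \<Longrightarrow> leavitt_eq E x z"
| cong_Neg: "leavitt_eq E x y \<Longrightarrow> leavitt_eq E (Neg x) (Neg y)"
| cong_Add: "leavitt_eq E x x' \<Longrightarrow> leavitt_eq E y y' \<Longrightarrow> leavitt_eq E (Add x y) (Add x' y')"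
| cong_Mult: "leavitt_eq E x x' \<Longrightarrow> leavitt_eq E y y' \<Longrightarrow> leavitt_eq E (Mult x y) (Mult x' y')"
| cong_Scale: "leavitt_eq E x y \<Longrightarrow> leavitt_eq E (Scale c x) (Scale c y)"
| add_assoc: "leavitt_eq E (Add (Add x y) z) (Add x (Add y z))"
| add_commute: "leavitt_eq E (Add x y) (Add y x)"
| add_zero: "leavitt_eq E (Add Zero x) x"
| add_neg: "leavitt_eq E (Add (Neg x) x) Zero"
| mult_assoc: "leavitt_eq E (Mult (Mult x y) z) (Mult x (Mult y z))"
| distrib_right: "leavitt_eq E (Mult (Add x y) z) (Add (Mult x z) (Mult y z))"
| distrib_left: "leavitt_eq E (Mult z (Add x y)) (Add (Mult z x) (Mult z y))"
| scale_add_left: "leavitt_eq E (Scale (c + d) x) (Add (Scale c x) (Scale d x))"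
| scale_add_right: "leavitt_eq E (Scale c (Add x y)) (Add (Scale c x) (Scale c y))"
| scale_scale: "leavitt_eq E (Scale (c * d) x) (Scale c (Scale d x))"
| scale_one: "leavitt_eq E (Scale 1 x) x"
| scale_mult_left: "leavitt_eq E (Scale c (Mult x y)) (Mult (Scale c x) y)"
| scale_mult_right: "leavitt_eq E (Scale c (Mult x y)) (Mult x (Scale c y))"
| vertex_idem: "v \<in> verts E \<Longrightarrow> leavitt_eq E (Mult (Vertex v) (Vertex v)) (Vertex v)"
| vertex_orth: "v \<in> verts E \<Longrightarrow> w \<in> verts E \<Longrightarrow> v \<noteq> w
    \<Longrightarrow> leavitt_eq E (Mult (Vertex v) (Vertex w)) Zero"
| tail_edge: "e \<in> arcs E \<Longrightarrow> leavitt_eq E (Mult (Vertex (tail E e)) (Edge e)) (Edge e)"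
| edge_head: "e \<in> arcs E \<Longrightarrow> leavitt_eq E (Mult (Edge e) (Vertex (head E e))) (Edge e)"
| head_ghost: "e \<in> arcs E \<Longrightarrow> leavitt_eq E (Mult (Vertex (head E e)) (Ghost e)) (Ghost e)"
| ghost_tail: "e \<in> arcs E \<Longrightarrow> leavitt_eq E (Mult (Ghost e) (Vertex (tail E e))) (Ghost e)"
| ghost_edge_same: "e \<in> arcs E \<Longrightarrow> leavitt_eq E (Mult (Ghost e) (Edge e)) (Vertex (head E e))"
| ghost_edge_diff: "e \<in> arcs E \<Longrightarrow> f \<in> arcs E \<Longrightarrow> e \<noteq> f
    \<Longrightarrow> leavitt_eq E (Mult (Ghost e) (Edge f)) Zero"
| emitter: "finite_emitter E v \<Longrightarrow> distinct es \<Longrightarrow> set es = out_arcs E v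
    \<Longrightarrow> leavitt_eq E (Vertex v) (foldr (\<lambda>e. Add (Mult (Edge e) (Ghost e))) es Zero)"
| no_vertex: "v \<notin> verts E \<Longrightarrow> leavitt_eq E (Vertex v) Zero"
| no_edge: "e \<notin> arcs E \<Longrightarrow> leavitt_eq E (Edge e) Zero"
| no_ghost: "e \<notin> arcs E \<Longrightarrow> leavitt_eq E (Ghost e) Zero"

definition leavitt_rel ::
  "('v,'e) pre_digraph \<Rightarrow> (('k::field,'v,'e) leavitt_term \<times> ('k,'v,'e) leavitt_term) set" where
  "leavitt_rel E = {(s, t). leavitt_eq E s t}"

definition leavitt_class ::
  "('v,'e) pre_digraph \<Rightarrow> ('k::field,'v,'e) leavitt_term \<Rightarrow> ('k,'v,'e) leavitt_term set" where
  "leavitt_class E t = leavitt_rel E `` {t}"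

text \<open>The field \<^const>\<open>one\<close> is left unspecified, as the algebra has no unit in general.\<close>

definition leavitt_path_algebra ::
  "'k::field itself \<Rightarrow> ('v,'e) pre_digraph \<Rightarrow> ('k, ('k,'v,'e) leavitt_term set) module" where
  "leavitt_path_algebra _ E = \<lparr>
     carrier = UNIV // leavitt_rel E,
     mult = (\<lambda>A B. \<Union>a\<in>A. \<Union>b\<in>B. leavitt_class E (Mult a b)),
     one = undefined,
     zero = leavitt_class E Zero,
     add = (\<lambda>A B. \<Union>a\<in>A. \<Union>b\<in>B. leavitt_class E (Add a b)),
     smult = (\<lambda>c A. \<Union>a\<in>A. leavitt_class E (Scale c a))\<rparr>"


subsection \<open>Universal property\<close>

lemma equiv_leavitt_rel: "equiv UNIV (leavitt_rel E)"
  unfolding leavitt_rel_def equiv_def refl_on_def sym_def trans_def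
  by (auto intro: leavitt_eq.refl leavitt_eq.sym leavitt_eq.trans)

lemma leavitt_class_eq_iff: "leavitt_class E s = leavitt_class E t \<longleftrightarrow> leavitt_eq E s t"
  unfolding leavitt_class_def eq_equiv_class_iff[OF equiv_leavitt_rel UNIV_I UNIV_I]
  by (simp add: leavitt_rel_def)

lemma mem_leavitt_class: "s \<in> leavitt_class E t \<longleftrightarrow> leavitt_eq E t s"
  by (simp add: leavitt_class_def leavitt_rel_def)

lemma UN_leavitt_class:
  assumes "\<And>a. leavitt_eq E s a \<Longrightarrow> leavitt_eq E (F s) (F a)"
  shows "(\<Union>a\<in>leavitt_class E s. leavitt_class E (F a)) = leavitt_class E (F s)"
proof (rule UN_constant_eq[of s])
  show "s \<in> leavitt_class E s"
    unfolding mem_leavitt_class by (rule leavitt_eq.refl)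
  show "\<forall>a\<in>leavitt_class E s. leavitt_class E (F a) = leavitt_class E (F s)"
    unfolding leavitt_class_eq_iff mem_leavitt_class Ball_def
    by (intro allI impI leavitt_eq.sym[OF assms])
qed

lemma UN2_leavitt_class:
  assumes F: "\<And>a b. leavitt_eq E s a \<Longrightarrow> leavitt_eq E t b \<Longrightarrow> leavitt_eq E (F s t) (F a b)"
  shows "(\<Union>a\<in>leavitt_class E s. \<Union>b\<in>leavitt_class E t. leavitt_class E (F a b))
    = leavitt_class E (F s t)"
proof (rule UN_constant_eq[of s])
  show "s \<in> leavitt_class E s"
    unfolding mem_leavitt_class by (rule leavitt_eq.refl)
  show "\<forall>a\<in>leavitt_class E s.
    (\<Union>b\<in>leavitt_class E t. leavitt_class E (F a b)) = leavitt_class E (F s t)"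
  proof
    fix a assume a: "a \<in> leavitt_class E s"
    show "(\<Union>b\<in>leavitt_class E t. leavitt_class E (F a b)) = leavitt_class E (F s t)"
    proof (rule UN_constant_eq[of t])
      show "t \<in> leavitt_class E t"
        unfolding mem_leavitt_class by (rule leavitt_eq.refl)
      show "\<forall>b\<in>leavitt_class E t. leavitt_class E (F a b) = leavitt_class E (F s t)"
        using a F unfolding leavitt_class_eq_iff mem_leavitt_class Ball_def
        by (intro allI impI leavitt_eq.sym[OF F])
    qed
  qed
qed

context
  fixes E :: "('v,'e) pre_digraph" and L :: "('k::field, ('k,'v,'e) leavitt_term set) module"
  defines "L \<equiv> leavitt_path_algebra TYPE('k) E"
begin

lemma carrier_L: "carrier L = range (leavitt_class E)"
  unfolding L_def leavitt_path_algebra_def by (auto simp: quotient_def leavitt_class_def)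

lemma zero_L: "\<zero>\<^bsub>L\<^esub> = leavitt_class E Zero"
  by (simp add: L_def leavitt_path_algebra_def)

lemma add_L: "leavitt_class E s \<oplus>\<^bsub>L\<^esub> leavitt_class E t = leavitt_class E (Add s t)"
  using UN2_leavitt_class[of E s t Add, OF leavitt_eq.cong_Add]
  by (simp add: L_def leavitt_path_algebra_def)

lemma mult_L: "leavitt_class E s \<otimes>\<^bsub>L\<^esub> leavitt_class E t = leavitt_class E (Mult s t)"
  using UN2_leavitt_class[of E s t Mult, OF leavitt_eq.cong_Mult]
  by (simp add: L_def leavitt_path_algebra_def)

lemma smult_L: "c \<odot>\<^bsub>L\<^esub> leavitt_class E t = leavitt_class E (Scale c t)"
  using UN_leavitt_class[of E t "Scale c", OF leavitt_eq.cong_Scale]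
  by (simp add: L_def leavitt_path_algebra_def)

theorem leavitt_path_algebra_is_algebra: "nonunital_algebra L"
proof -
  have "abelian_group L"
  proof (rule abelian_groupI)
    fix x assume "x \<in> carrier L"
    then obtain s where "x = leavitt_class E s" by (auto simp: carrier_L)
    then show "\<exists>y\<in>carrier L. y \<oplus>\<^bsub>L\<^esub> x = \<zero>\<^bsub>L\<^esub>"
      by (intro bexI[of _ "leavitt_class E (Neg s)"])
        (auto simp: carrier_L zero_L add_L leavitt_class_eq_iff intro: leavitt_eq.add_neg)
  qed (auto simp: carrier_L zero_L add_L leavitt_class_eq_iff
      intro: leavitt_eq.add_assoc leavitt_eq.add_commute leavitt_eq.add_zero rangeI del: equalityI)
  then interpret abelian_group L .
  show ?thesis
    by unfold_locales
      (auto simp: carrier_L add_L mult_L smult_L leavitt_class_eq_iff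
        intro: leavitt_eq.mult_assoc leavitt_eq.distrib_left leavitt_eq.distrib_right
          leavitt_eq.scale_add_left leavitt_eq.scale_add_right leavitt_eq.scale_scale
          leavitt_eq.scale_one leavitt_eq.scale_mult_left leavitt_eq.scale_mult_right rangeI
        del: equalityI)
qed

lemma finsum_L:
  assumes "distinct es"
  shows "(\<Oplus>\<^bsub>L\<^esub>e\<in>set es. leavitt_class E (g e)) = leavitt_class E (foldr (\<lambda>e. Add (g e)) es Zero)"
proof -
  interpret nonunital_algebra L by (rule leavitt_path_algebra_is_algebra)
  show ?thesis using assms
    by (induction es) (auto simp: zero_L add_L carrier_L Pi_iff)
qed

theorem leavitt_path_algebra_family:
  "leavitt_family E L (\<lambda>v. leavitt_class E (Vertex v)) (\<lambda>e. leavitt_class E (Edge e))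
     (\<lambda>e. leavitt_class E (Ghost e))"
proof -
  have ck2: "leavitt_class E (Vertex v) =
      (\<Oplus>\<^bsub>L\<^esub>e\<in>out_arcs E v. leavitt_class E (Edge e) \<otimes>\<^bsub>L\<^esub> leavitt_class E (Ghost e))"
    if v: "finite_emitter E v" for v
  proof -
    obtain es where "set es = out_arcs E v" "distinct es"
      using v finite_distinct_list unfolding finite_emitter_def by blast
    then show ?thesis
      using finsum_L[of es "\<lambda>e. Mult (Edge e) (Ghost e)"] leavitt_eq.emitter[OF v, of es]
      by (simp add: mult_L leavitt_class_eq_iff)
  qed
  show ?thesis
    unfolding leavitt_family_def
  proof (intro conjI)
    show "\<forall>v. finite_emitter E v \<longrightarrow> leavitt_class E (Vertex v) =
      (\<Oplus>\<^bsub>L\<^esub>e\<in>out_arcs E v. leavitt_class E (Edge e) \<otimes>\<^bsub>L\<^esub> leavitt_class E (Ghost e))"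
      using ck2 by blast
  qed (simp_all add: rangeI carrier_L mult_L zero_L leavitt_class_eq_iff leavitt_eq.vertex_idem
      leavitt_eq.vertex_orth leavitt_eq.tail_edge leavitt_eq.edge_head leavitt_eq.head_ghost
      leavitt_eq.ghost_tail leavitt_eq.ghost_edge_same leavitt_eq.ghost_edge_diff)
qed

primrec leavitt_eval ::
  "('k,'a,'m) module_scheme \<Rightarrow> ('v \<Rightarrow> 'a) \<Rightarrow> ('e \<Rightarrow> 'a) \<Rightarrow> ('e \<Rightarrow> 'a) \<Rightarrow> ('k,'v,'e) leavitt_term \<Rightarrow> 'a"
where
  "leavitt_eval R P X Y (Vertex v) = (if v \<in> verts E then P v else \<zero>\<^bsub>R\<^esub>)"
| "leavitt_eval R P X Y (Edge e) = (if e \<in> arcs E then X e else \<zero>\<^bsub>R\<^esub>)"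
| "leavitt_eval R P X Y (Ghost e) = (if e \<in> arcs E then Y e else \<zero>\<^bsub>R\<^esub>)"
| "leavitt_eval R P X Y Zero = \<zero>\<^bsub>R\<^esub>"
| "leavitt_eval R P X Y (Neg s) = \<ominus>\<^bsub>R\<^esub> leavitt_eval R P X Y s"
| "leavitt_eval R P X Y (Add s t) = leavitt_eval R P X Y s \<oplus>\<^bsub>R\<^esub> leavitt_eval R P X Y t"
| "leavitt_eval R P X Y (Mult s t) = leavitt_eval R P X Y s \<otimes>\<^bsub>R\<^esub> leavitt_eval R P X Y t"
| "leavitt_eval R P X Y (Scale c s) = c \<odot>\<^bsub>R\<^esub> leavitt_eval R P X Y s"

theorem leavitt_path_algebra_universal:
  fixes R :: "('k,'a,'m) module_scheme"
  assumes E: "wf_digraph E" and R: "nonunital_algebra R" and fam: "leavitt_family E R P X Y"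
  shows "\<exists>!f. f \<in> algebra_hom L R \<inter> extensional (carrier L) \<and>
    (\<forall>v\<in>verts E. f (leavitt_class E (Vertex v)) = P v) \<and>
    (\<forall>e\<in>arcs E. f (leavitt_class E (Edge e)) = X e \<and> f (leavitt_class E (Ghost e)) = Y e)"
proof -
  interpret R: nonunital_algebra R by (rule R)
  interpret E: wf_digraph E by (rule E)
  interpret L: nonunital_algebra L by (rule leavitt_path_algebra_is_algebra)
  let ?h = "leavitt_eval R P X Y"
  note fam' = fam[unfolded leavitt_family_def]
  have closed: "?h t \<in> carrier R" for t
    using fam' by (induction t) (auto simp: R.m_closed R.smult_closed)
  have fold: "?h (foldr (\<lambda>e. Add (Mult (Edge e) (Ghost e))) es Zero)
      = (\<Oplus>\<^bsub>R\<^esub>e\<in>set es. X e \<otimes>\<^bsub>R\<^esub> Y e)"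
    if "distinct es" "set es \<subseteq> arcs E" for es
    using that
  proof (induction es)
    case (Cons e es)
    have "(\<lambda>e. X e \<otimes>\<^bsub>R\<^esub> Y e) \<in> Pi (set es) (\<lambda>_. carrier R)" "X e \<otimes>\<^bsub>R\<^esub> Y e \<in> carrier R"
      using Cons.prems fam' by (auto simp: Pi_iff intro!: R.m_closed)
    then show ?case using Cons by simp
  qed simp
  have eq: "?h s = ?h t" if "leavitt_eq E s t" for s t
    using that
  proof (induction rule: leavitt_eq.induct)
    case (emitter v es)
    then show ?case
      using fam' fold[of es] out_arcs_def[of E v] by (simp add: finite_emitter_def)
  next
    case (add_commute x y)
    then show ?case using R.a_comm[OF closed closed] by simp
  qed (use fam' closed in \<open>simp_all add: R.a_assoc R.l_neg R.m_assoc R.l_distr R.r_distr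
      R.smult_l_distr R.smult_r_distr R.smult_assoc R.smult_one
      flip: R.smult_mult_l R.smult_mult_r\<close>)
  define f where "f = (\<lambda>A\<in>carrier L. ?h (SOME t. A = leavitt_class E t))"
  have f: "f (leavitt_class E t) = ?h t" for t
  proof -
    have "leavitt_class E t = leavitt_class E (SOME s. leavitt_class E t = leavitt_class E s)"
      by (rule someI) (rule HOL.refl)
    then have "?h t = ?h (SOME s. leavitt_class E t = leavitt_class E s)"
      unfolding leavitt_class_eq_iff by (rule eq)
    then show ?thesis by (simp add: f_def carrier_L)
  qed
  show ?thesis
  proof (rule ex1I[of _ f])
    have "f \<in> extensional (carrier L)" by (simp add: f_def)
    moreover have "f \<in> algebra_hom L R"
      by (auto simp: algebra_hom_def carrier_L add_L mult_L smult_L f closed)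
    ultimately show "f \<in> algebra_hom L R \<inter> extensional (carrier L) \<and>
      (\<forall>v\<in>verts E. f (leavitt_class E (Vertex v)) = P v) \<and>
      (\<forall>e\<in>arcs E. f (leavitt_class E (Edge e)) = X e \<and> f (leavitt_class E (Ghost e)) = Y e)"
      by (simp add: f)
  next
    fix g assume g: "g \<in> algebra_hom L R \<inter> extensional (carrier L) \<and>
      (\<forall>v\<in>verts E. g (leavitt_class E (Vertex v)) = P v) \<and>
      (\<forall>e\<in>arcs E. g (leavitt_class E (Edge e)) = X e \<and> g (leavitt_class E (Ghost e)) = Y e)"
    have in_L: "leavitt_class E t \<in> carrier L" for t by (simp add: carrier_L)
    have in_R: "g (leavitt_class E t) \<in> carrier R" for t
      using g in_L[of t] by (auto simp: algebra_hom_def)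
    have g_add: "g (leavitt_class E (Add s t)) = g (leavitt_class E s) \<oplus>\<^bsub>R\<^esub> g (leavitt_class E t)"
      for s t using g in_L[of s] in_L[of t] by (auto simp: algebra_hom_def simp flip: add_L)
    have g_mult: "g (leavitt_class E (Mult s t)) = g (leavitt_class E s) \<otimes>\<^bsub>R\<^esub> g (leavitt_class E t)"
      for s t using g in_L[of s] in_L[of t] by (auto simp: algebra_hom_def simp flip: mult_L)
    have g_smult: "g (leavitt_class E (Scale c t)) = c \<odot>\<^bsub>R\<^esub> g (leavitt_class E t)"
      for c t using g in_L[of t] by (auto simp: algebra_hom_def simp flip: smult_L)
    have "leavitt_class E (Add Zero Zero) = leavitt_class E Zero"
      by (simp add: leavitt_class_eq_iff leavitt_eq.add_zero)
    then have "g (leavitt_class E Zero) = g (leavitt_class E Zero) \<oplus>\<^bsub>R\<^esub> g (leavitt_class E Zero)"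
      using g_add[of Zero Zero] by metis
    then have g_zero: "g (leavitt_class E Zero) = \<zero>\<^bsub>R\<^esub>"
      using in_R[of Zero] R.add.r_cancel_one' by metis
    have g_neg: "g (leavitt_class E (Neg t)) = \<ominus>\<^bsub>R\<^esub> g (leavitt_class E t)" for t
    proof -
      have "leavitt_class E (Add (Neg t) t) = leavitt_class E Zero"
        by (simp add: leavitt_class_eq_iff leavitt_eq.add_neg)
      then have "g (leavitt_class E (Neg t)) \<oplus>\<^bsub>R\<^esub> g (leavitt_class E t) = \<zero>\<^bsub>R\<^esub>"
        using g_add[of "Neg t" t] g_zero by metis
      then show ?thesis using in_R R.minus_equality by metis
    qed
    have junk: "leavitt_class E t = leavitt_class E Zero" if "leavitt_eq E t Zero"
      for t :: "('k,'v,'e) leavitt_term"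
      using that by (simp add: leavitt_class_eq_iff)
    have "g (leavitt_class E t) = ?h t" for t
    proof (induction t)
      case (Vertex v)
      then show ?case using g g_zero junk[OF leavitt_eq.no_vertex] by auto
    next
      case (Edge e)
      then show ?case using g g_zero junk[OF leavitt_eq.no_edge] by auto
    next
      case (Ghost e)
      then show ?case using g g_zero junk[OF leavitt_eq.no_ghost] by auto
    qed (simp_all add: g_zero g_neg g_add g_mult g_smult)
    then have "g A = f A" if "A \<in> carrier L" for A
      using that by (auto simp: carrier_L f)
    moreover have "g \<in> extensional (carrier L)" "f \<in> extensional (carrier L)"
      using g by (auto simp: f_def)
    ultimately show "g = f" by (intro extensionalityI[of g "carrier L" f]) auto
  qed
qed

end

end

theory Submission
  imports Defs "HOL-Library.Sublist"
begin

text \<open>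
  Under the three conditions every vertex reaches the base \<open>w\<close> of a simple closed path \<open>c\<close>, and an
  exit of \<open>c\<close> gives a second closed path \<open>d\<close> at \<open>w\<close> such that neither of \<open>c\<close>, \<open>d\<close> is a prefix of the
  other. For every nonzero \<open>x\<close> there are then \<open>a\<close>, \<open>b\<close> with \<open>a x b = w\<close>: multiplying by arcs on the
  right removes the ghost arcs from \<open>x\<close>, multiplying by $p^*$ for a shortest path \<open>p\<close> of \<open>x\<close> and moving to
  \<open>w\<close> leaves \<open>k w + t\<close> with \<open>k \<noteq> 0\<close> and \<open>t\<close> a combination of nontrivial closed paths at \<open>w\<close>, and
  compression by \<open>c\<^sup>n d\<close> for large \<open>n\<close> kills \<open>t\<close>. Hence an ideal containing \<open>x\<close> contains \<open>w\<close>, and the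
  idempotent \<open>x b a\<close> is infinite because \<open>w\<close> is, as $c^* c = w \neq c c^*$.

  Conversely, an algebra of an acyclic graph is the union of finite-dimensional subalgebras and has
  no infinite idempotent. If one of the other two conditions fails, a representation on functions
  has a kernel that is neither zero nor everything.
\<close>

section \<open>Rings and algebras without unit\<close>

text \<open>The algebra is given by a presentation without normal forms, so nonvanishing needs a
  source of its own: a representation in which the element acts nontrivially. Sufficiency and the
  acyclic case ask for this at vertices only; otherwise they work with spanning sets and never with
  linear independence. The delicate point in removing ghost arcs is a vertex \<open>v\<close> with
  \<open>x \<otimes> P v\<close> nonzero although \<open>x \<otimes> X e\<close> vanishes for every
  arc \<open>e\<close>. At a finite emitter the relation for \<open>P v\<close> excludes this. At an
  infinite emitter there is no such relation; instead, the finitely many arcs occurring in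
  \<open>x\<close> leave another one that isolates the part without ghost arcs. As there is no unit,
  isomorphisms of right ideals are traded for pairs of elements with \<open>q p = g\<close> and
  \<open>p q \<noteq> g\<close>, and finite sums of orthogonal idempotents serve as local units. The
  representations have fibres \<open>nat\<close> because countably many disjoint copies of
  \<open>nat\<close> again fill \<open>nat\<close>: a fibre can be divided among the arcs leaving
  its vertex, be they finitely or infinitely many.\<close>

context nonunital_ring
begin

lemma l_null: "x \<in> carrier R \<Longrightarrow> \<zero> \<otimes> x = \<zero>"
proof -
  assume x: "x \<in> carrier R"
  then have "\<zero> \<otimes> x \<oplus> \<zero> \<otimes> x = \<zero> \<otimes> x"
    using l_distr[of \<zero> \<zero> x] by simp
  then show ?thesis using x by (simp add: m_closed)
qed

lemma r_null: "x \<in> carrier R \<Longrightarrow> x \<otimes> \<zero> = \<zero>"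
proof -
  assume x: "x \<in> carrier R"
  then have "x \<otimes> \<zero> \<oplus> x \<otimes> \<zero> = x \<otimes> \<zero>"
    using r_distr[of \<zero> \<zero> x] by simp
  then show ?thesis using x by (simp add: m_closed)
qed

lemma l_minus: "x \<in> carrier R \<Longrightarrow> y \<in> carrier R \<Longrightarrow> (\<ominus> x) \<otimes> y = \<ominus> (x \<otimes> y)"
  using l_distr[of "\<ominus> x" x y] by (simp add: m_closed l_neg l_null minus_equality)

lemma r_minus: "x \<in> carrier R \<Longrightarrow> y \<in> carrier R \<Longrightarrow> x \<otimes> (\<ominus> y) = \<ominus> (x \<otimes> y)"
  using r_distr[of "\<ominus> y" y x] by (simp add: m_closed l_neg r_null minus_equality)

lemma r_diff_distr:
  "\<lbrakk>x \<in> carrier R; y \<in> carrier R; z \<in> carrier R\<rbrakk> \<Longrightarrow> z \<otimes> (x \<ominus> y) = z \<otimes> x \<ominus> z \<otimes> y"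
  by (simp add: a_minus_def r_distr r_minus)

lemma finsum_ldistr:
  "finite A \<Longrightarrow> x \<in> carrier R \<Longrightarrow> f \<in> A \<rightarrow> carrier R \<Longrightarrow>
    (\<Oplus>i\<in>A. f i) \<otimes> x = (\<Oplus>i\<in>A. f i \<otimes> x)"
  by (induction A rule: finite_induct) (auto simp: l_null l_distr m_closed Pi_iff)

lemma finsum_rdistr:
  "finite A \<Longrightarrow> x \<in> carrier R \<Longrightarrow> f \<in> A \<rightarrow> carrier R \<Longrightarrow>
    x \<otimes> (\<Oplus>i\<in>A. f i) = (\<Oplus>i\<in>A. x \<otimes> f i)"
  by (induction A rule: finite_induct) (auto simp: r_null r_distr m_closed Pi_iff)

section \<open>Right ideals and infinite idempotents in terms of elements\<close>

lemma right_ideal_principal: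
  assumes a: "a \<in> carrier R"
  shows "right_ideal R (principal_right R a)"
  unfolding right_ideal_def
proof (intro conjI ballI)
  show "additive_subgroup (principal_right R a) R"
  proof (intro additive_subgroup.intro add.subgroupI)
    show "principal_right R a \<subseteq> carrier R" "principal_right R a \<noteq> {}"
      using a by (auto simp: principal_right_def m_closed)
  next
    fix x assume "x \<in> principal_right R a"
    then obtain r where "r \<in> carrier R" "x = a \<otimes> r" by (auto simp: principal_right_def)
    then show "\<ominus> x \<in> principal_right R a"
      using a r_minus[of a r] by (auto simp: principal_right_def intro!: exI[of _ "\<ominus> r"])
  next
    fix x y assume "x \<in> principal_right R a" "y \<in> principal_right R a"
    then obtain r s where "r \<in> carrier R" "x = a \<otimes> r" "s \<in> carrier R" "y = a \<otimes> s"
      by (auto simp: principal_right_def)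
    then show "x \<oplus> y \<in> principal_right R a"
      using a r_distr[of r s a] by (auto simp: principal_right_def intro!: exI[of _ "r \<oplus> s"])
  qed
  show "x \<otimes> r \<in> principal_right R a" if "x \<in> principal_right R a" "r \<in> carrier R" for x r
    using that a m_assoc m_closed by (fastforce simp: principal_right_def)
qed

lemma right_idealD:
  assumes "right_ideal R I"
  shows "I \<subseteq> carrier R" "\<zero> \<in> I" "x \<in> I \<Longrightarrow> y \<in> I \<Longrightarrow> x \<oplus> y \<in> I" "x \<in> I \<Longrightarrow> \<ominus> x \<in> I"
    "x \<in> I \<Longrightarrow> y \<in> I \<Longrightarrow> x \<ominus> y \<in> I" "x \<in> I \<Longrightarrow> r \<in> carrier R \<Longrightarrow> x \<otimes> r \<in> I"
proof -
  interpret additive_subgroup I R using assms by (simp add: right_ideal_def)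
  show "I \<subseteq> carrier R" "\<zero> \<in> I" "x \<in> I \<Longrightarrow> y \<in> I \<Longrightarrow> x \<oplus> y \<in> I"
    by (use a_subset zero_closed a_closed in auto)
  show *: "x \<in> I \<Longrightarrow> \<ominus> x \<in> I" for x
    using add.subgroupE(3)[OF a_subgroup] by simp
  show "x \<in> I \<Longrightarrow> y \<in> I \<Longrightarrow> x \<ominus> y \<in> I"
    using * a_closed by (simp add: a_minus_def)
  show "x \<in> I \<Longrightarrow> r \<in> carrier R \<Longrightarrow> x \<otimes> r \<in> I"
    using assms by (simp add: right_ideal_def)
qed

text \<open>The idempotent \<open>h = p q\<close> lies below \<open>g\<close>. Left multiplication
  by \<open>p\<close> carries \<open>g R\<close> onto \<open>h R\<close>, with inverse left
  multiplication by \<open>q\<close>, and \<open>(g - h) R\<close> is a complement;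
  \<open>h \<noteq> g\<close> makes the summand proper.\<close>

lemma infinite_idempotentI:
  assumes c: "g \<in> carrier R" "p \<in> carrier R" "q \<in> carrier R"
    and gg: "g \<otimes> g = g" and gp: "g \<otimes> p = p" and pg: "p \<otimes> g = p"
    and gq: "g \<otimes> q = q" and qg: "q \<otimes> g = q" and qp: "q \<otimes> p = g" and pq: "p \<otimes> q \<noteq> g"
  shows "infinite_idempotent R g"
proof -
  define h where "h = p \<otimes> q"
  have h: "h \<in> carrier R" "h \<otimes> h = h" "g \<otimes> h = h" "h \<otimes> g = h" "h \<otimes> p = p"
  proof -
    show "h \<in> carrier R" using c by (simp add: h_def m_closed)
    show "h \<otimes> p = p" using c pg qp by (simp add: h_def m_assoc)
    then show "h \<otimes> h = h" using c by (simp add: h_def m_closed flip: m_assoc)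
    show "g \<otimes> h = h" using c gp by (simp add: h_def flip: m_assoc)
    show "h \<otimes> g = h" using c qg by (simp add: h_def m_assoc)
  qed
  define k where "k = g \<ominus> h"
  have k: "k \<in> carrier R" "g \<otimes> k = k" "h \<otimes> k = \<zero>"
    using c h gg by (simp_all add: k_def r_diff_distr r_neg a_minus_def r_distr r_minus)
  have hk: "h \<oplus> k = g"
    using c h by (simp add: k_def a_minus_def a_lcomm[of h g] r_neg)
  have sum: "principal_right R h <+>\<^bsub>R\<^esub> principal_right R k = principal_right R g"
  proof
    show "principal_right R h <+>\<^bsub>R\<^esub> principal_right R k \<subseteq> principal_right R g"
    proof
      fix x assume "x \<in> principal_right R h <+>\<^bsub>R\<^esub> principal_right R k"
      then obtain r s where rs: "r \<in> carrier R" "s \<in> carrier R" "x = h \<otimes> r \<oplus> k \<otimes> s"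
        by (auto simp: set_add_def' principal_right_def)
      then have "x = g \<otimes> (h \<otimes> r \<oplus> k \<otimes> s)"
        using c h k by (simp add: r_distr m_closed flip: m_assoc)
      then show "x \<in> principal_right R g"
        using rs h k by (auto simp: principal_right_def m_closed)
    qed
    show "principal_right R g \<subseteq> principal_right R h <+>\<^bsub>R\<^esub> principal_right R k"
    proof
      fix x assume "x \<in> principal_right R g"
      then obtain r where "r \<in> carrier R" "x = g \<otimes> r"
        by (auto simp: principal_right_def)
      then have "x = h \<otimes> r \<oplus> k \<otimes> r"
        using h k l_distr[of h k r] by (simp add: hk)
      then show "x \<in> principal_right R h <+>\<^bsub>R\<^esub> principal_right R k"
        using \<open>r \<in> carrier R\<close> by (auto simp: set_add_def' principal_right_def)
    qed
  qed
  have "principal_right R h \<inter> principal_right R k \<subseteq> {\<zero>}"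
  proof
    fix x assume "x \<in> principal_right R h \<inter> principal_right R k"
    then obtain r s where rs: "r \<in> carrier R" "s \<in> carrier R" "x = h \<otimes> r" "x = k \<otimes> s"
      by (auto simp: principal_right_def)
    have "x = h \<otimes> x" using rs h by (simp flip: m_assoc)
    also have "\<dots> = \<zero>"
      unfolding rs(4) using rs(1,2) h k by (simp add: l_null flip: m_assoc)
    finally show "x \<in> {\<zero>}" by simp
  qed
  then have int: "principal_right R h \<inter> principal_right R k = {\<zero>}"
    using right_idealD(2)[OF right_ideal_principal] h k by auto
  \<comment> \<open>\<open>h\<close> is a left identity on \<open>h R\<close>, so \<open>g\<close>
    in \<open>h R\<close> would force \<open>g = h g = h\<close>.\<close>
  have "g \<notin> principal_right R h"
  proof
    assume "g \<in> principal_right R h"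
    then obtain r where "r \<in> carrier R" "g = h \<otimes> r" by (auto simp: principal_right_def)
    then have "h \<otimes> g = g" using h by (simp flip: m_assoc)
    then show False using h pq by (simp add: h_def)
  qed
  moreover have "g \<in> principal_right R g" using c gg by (force simp: principal_right_def)
  ultimately have ne: "principal_right R h \<noteq> principal_right R g" by blast
  have "bij_betw ((\<otimes>) p) (principal_right R g) (principal_right R h)"
  proof (rule bij_betw_byWitness[of _ "(\<otimes>) q"])
    have "q \<otimes> (p \<otimes> (g \<otimes> r)) = g \<otimes> r" if "r \<in> carrier R" for r
    proof -
      have "q \<otimes> (p \<otimes> (g \<otimes> r)) = (q \<otimes> p) \<otimes> (g \<otimes> r)"
        using c that by (simp add: m_assoc m_closed)
      also have "\<dots> = (g \<otimes> g) \<otimes> r" using c that by (simp add: qp m_assoc)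
      also have "\<dots> = g \<otimes> r" by (simp add: gg)
      finally show ?thesis .
    qed
    then show "\<forall>x\<in>principal_right R g. q \<otimes> (p \<otimes> x) = x"
      by (auto simp: principal_right_def)
    show "\<forall>x\<in>principal_right R h. p \<otimes> (q \<otimes> x) = x"
      using c h h_def by (auto simp: principal_right_def m_closed simp flip: m_assoc)
    show "(\<otimes>) p ` principal_right R g \<subseteq> principal_right R h"
    proof
      fix x assume "x \<in> (\<otimes>) p ` principal_right R g"
      then obtain r where "r \<in> carrier R" "x = p \<otimes> (g \<otimes> r)" by (auto simp: principal_right_def)
      then have "x = h \<otimes> (p \<otimes> r)" using c h pg by (simp flip: m_assoc)
      then show "x \<in> principal_right R h"
        using c \<open>r \<in> carrier R\<close> by (auto simp: principal_right_def m_closed)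
    qed
    show "(\<otimes>) q ` principal_right R h \<subseteq> principal_right R g"
    proof
      fix x assume "x \<in> (\<otimes>) q ` principal_right R h"
      then obtain r where "r \<in> carrier R" "x = q \<otimes> (h \<otimes> r)" by (auto simp: principal_right_def)
      then have "x = g \<otimes> (q \<otimes> r)" using c h qp gq by (simp add: h_def m_closed flip: m_assoc)
      then show "x \<in> principal_right R g"
        using c \<open>r \<in> carrier R\<close> by (auto simp: principal_right_def m_closed)
    qed
  qed
  then have "right_module_iso R (principal_right R g) (principal_right R h) ((\<otimes>) p)"
    using c by (auto simp: right_module_iso_def principal_right_def m_closed m_assoc intro!: r_distr)
  moreover have "direct_summand R (principal_right R h) (principal_right R g)"
    unfolding direct_summand_def
    using right_ideal_principal h k sum int by blast
  ultimately show ?thesis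
    unfolding infinite_idempotent_def using c gg ne by blast
qed

text \<open>The isomorphism \<open>f\<close> is left multiplication by \<open>x = f a\<close>, and
  the component \<open>n\<close> of \<open>a\<close> in \<open>N\<close> is a left identity on
  \<open>N\<close>. For \<open>f y = n\<close> this gives \<open>f (y x) = n x = x = f a\<close>,
  hence \<open>y x = a\<close>. That \<open>a\<close> is not in \<open>x R\<close> records that the
  summand is proper.\<close>

lemma infinite_idempotentE:
  assumes "infinite_idempotent R a"
  obtains x y where "a \<in> carrier R" "x \<in> carrier R" "y \<in> carrier R" "a \<otimes> x = x" "x \<otimes> a = x"
    "y \<otimes> x = a" "a \<notin> principal_right R x"
proof -
  obtain N P f where a: "a \<in> carrier R" "a \<otimes> a = a"
    and N: "right_ideal R N" and P: "right_ideal R P"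
    and sum: "N <+>\<^bsub>R\<^esub> P = principal_right R a" and int: "N \<inter> P = {\<zero>}"
    and ne: "N \<noteq> principal_right R a" and iso: "right_module_iso R (principal_right R a) N f"
    using assms unfolding infinite_idempotent_def direct_summand_def by blast
  let ?A = "principal_right R a"
  note Nc = right_idealD[OF N] and Pc = right_idealD[OF P]
    and Ac = right_idealD[OF right_ideal_principal[OF a(1)]]
  have bij: "bij_betw f ?A N" and f: "\<And>z r. z \<in> ?A \<Longrightarrow> r \<in> carrier R \<Longrightarrow> f (z \<otimes> r) = f z \<otimes> r"
    using iso by (auto simp: right_module_iso_def)
  have aA: "a \<in> ?A" using a by (force simp: principal_right_def)
  have az: "a \<otimes> z = z" if "z \<in> ?A" for z
    using that a by (auto simp: principal_right_def simp flip: m_assoc)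
  have "n \<in> N <+>\<^bsub>R\<^esub> P" if "n \<in> N" for n
  proof -
    have "n = n \<oplus> \<zero>" using that Nc(1) by (simp add: subset_iff)
    then show ?thesis using that Pc(2) unfolding set_add_def' by blast
  qed
  then have NA: "N \<subseteq> ?A" using sum by blast
  define x where "x = f a"
  have xN: "x \<in> N" using bij aA by (auto simp: x_def bij_betw_def)
  obtain n p where np: "n \<in> N" "p \<in> P" "a = n \<oplus> p"
  proof -
    have "a \<in> N <+>\<^bsub>R\<^esub> P" using aA sum by simp
    then have "\<exists>n\<in>N. \<exists>p\<in>P. a = n \<oplus> p" by (simp add: set_add_def')
    then show ?thesis using that by blast
  qed
  have nc: "n \<in> carrier R" "p \<in> carrier R" using np Nc(1) Pc(1) by auto
  \<comment> \<open>\<open>p z = z - n z\<close> lies in \<open>P\<close> and in \<open>N\<close>,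
    hence vanishes.\<close>
  have n_left: "n \<otimes> z = z" if z: "z \<in> N" for z
  proof -
    have zc: "z \<in> carrier R" using z Nc(1) by auto
    have nz: "n \<otimes> z \<oplus> p \<otimes> z = z"
    proof -
      have "a \<otimes> z = z" using az z NA by blast
      then show ?thesis using nc zc by (simp add: np(3) l_distr)
    qed
    then have "p \<otimes> z = \<ominus> (n \<otimes> z) \<oplus> z"
    proof -
      have "\<ominus> (n \<otimes> z) \<oplus> (n \<otimes> z \<oplus> p \<otimes> z) = p \<otimes> z"
        using nc zc by (simp add: m_closed l_neg flip: a_assoc)
      then show ?thesis by (simp only: nz)
    qed
    moreover have "\<ominus> (n \<otimes> z) \<oplus> z \<in> N" using Nc(3,4,6) np zc z by simp
    ultimately have "p \<otimes> z \<in> N" by simp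
    moreover have "p \<otimes> z \<in> P" using Pc(6) np(2) zc by simp
    ultimately have "p \<otimes> z = \<zero>" using int by blast
    then show ?thesis using nz nc zc by (simp add: m_closed)
  qed
  obtain y where y: "y \<in> ?A" "f y = n" using bij np by (auto simp: bij_betw_def)
  have c: "x \<in> carrier R" "y \<in> carrier R" using xN Nc(1) y Ac(1) by auto
  have yx: "y \<otimes> x = a"
  proof -
    have "f (y \<otimes> x) = f a" using f[OF y(1) c(1)] y(2) n_left[OF xN] by (simp add: x_def)
    moreover have "y \<otimes> x \<in> ?A" using y(1) c(1) by (rule Ac(6))
    ultimately show ?thesis using bij aA by (meson bij_betw_def inj_onD)
  qed
  have "a \<notin> principal_right R x"
  proof
    assume "a \<in> principal_right R x"
    then have "a \<in> N" using Nc(6)[OF xN] by (auto simp: principal_right_def)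
    then have "?A \<subseteq> N" using Nc(6) by (auto simp: principal_right_def)
    then show False using ne NA by blast
  qed
  moreover have "x \<otimes> a = x" using f[OF aA a(1)] a by (simp add: x_def)
  moreover have "a \<otimes> x = x" using az xN NA by blast
  ultimately show ?thesis using that[OF a(1) c] yx by simp
qed

end

section \<open>Linear spans, built by adding one scaled generator at a time\<close>

inductive_set lspan :: "('k,'a,'m) module_scheme \<Rightarrow> 'a set \<Rightarrow> 'a set"
  for R (structure) and G where
  zero: "\<zero> \<in> lspan R G"
| step: "g \<in> G \<Longrightarrow> x \<in> lspan R G \<Longrightarrow> c \<odot> g \<oplus> x \<in> lspan R G"

lemma lspan_mono: "G \<subseteq> H \<Longrightarrow> lspan R G \<subseteq> lspan R H"
proof
  fix x assume "G \<subseteq> H" "x \<in> lspan R G"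
  from this(2,1) show "x \<in> lspan R H"
    by induction (auto intro: lspan.intros)
qed

context nonunital_algebra
begin

lemma smult_zero: "c \<odot> \<zero> = \<zero>"
  using smult_r_distr[of \<zero> \<zero> c] by (simp add: smult_closed)

lemma zero_smult: "x \<in> carrier R \<Longrightarrow> 0 \<odot> x = \<zero>"
  using smult_l_distr[of x 0 0] by (simp add: smult_closed)

lemma minus_one_smult: "x \<in> carrier R \<Longrightarrow> (- 1) \<odot> x = \<ominus> x"
  using smult_l_distr[of x "- 1" 1]
  by (intro minus_equality[symmetric]) (simp_all add: smult_closed smult_one zero_smult)

lemma lspan_closed: "x \<in> lspan R G \<Longrightarrow> G \<subseteq> carrier R \<Longrightarrow> x \<in> carrier R"
  by (induction rule: lspan.induct) (auto simp: smult_closed)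

lemma lspan_base: "g \<in> G \<Longrightarrow> G \<subseteq> carrier R \<Longrightarrow> g \<in> lspan R G"
  using lspan.step[OF _ lspan.zero, of g G R 1] by (auto simp: smult_one)

lemma lspan_add:
  assumes "x \<in> lspan R G" "y \<in> lspan R G" and G: "G \<subseteq> carrier R"
  shows "x \<oplus> y \<in> lspan R G"
  using assms(1)
proof induction
  case zero
  then show ?case using assms lspan_closed[of y] by simp
next
  case (step g x c)
  have "g \<in> carrier R" "x \<in> carrier R" "y \<in> carrier R"
    using step.hyps assms lspan_closed by auto
  then show ?case
    using lspan.step[OF step.hyps(1) step.IH, of c] by (simp add: a_assoc smult_closed)
qed

lemma lspan_smult:
  assumes "x \<in> lspan R G" and G: "G \<subseteq> carrier R"
  shows "c \<odot> x \<in> lspan R G"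
  using assms(1)
proof induction
  case zero
  then show ?case by (simp add: smult_zero lspan.zero)
next
  case (step g x d)
  have "g \<in> carrier R" "x \<in> carrier R" using step.hyps assms lspan_closed by auto
  then show ?case
    using lspan.step[OF step.hyps(1) step.IH, of "c * d"]
    by (simp add: smult_r_distr smult_assoc smult_closed)
qed

lemma lspan_subset_lspan:
  assumes "G \<subseteq> lspan R H" and H: "H \<subseteq> carrier R"
  shows "lspan R G \<subseteq> lspan R H"
proof
  fix x assume "x \<in> lspan R G"
  then show "x \<in> lspan R H"
    by induction (use assms in \<open>auto intro: lspan.zero lspan_add lspan_smult\<close>)
qed

lemma lspan_linear_image:
  assumes x: "x \<in> lspan R G" and G: "G \<subseteq> carrier R" and H: "H \<subseteq> carrier R"
    and a: "a \<in> carrier R" and b: "b \<in> carrier R"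
    and ab: "\<And>g. g \<in> G \<Longrightarrow> a \<otimes> g \<otimes> b \<in> lspan R H"
  shows "a \<otimes> x \<otimes> b \<in> lspan R H"
  using x
proof induction
  case zero
  then show ?case using a b by (simp add: r_null l_null lspan.zero)
next
  case (step g x c)
  have gx: "g \<in> carrier R" "x \<in> carrier R" using step.hyps assms lspan_closed by auto
  have "a \<otimes> (c \<odot> g \<oplus> x) \<otimes> b = c \<odot> (a \<otimes> g \<otimes> b) \<oplus> a \<otimes> x \<otimes> b"
    using gx a b
    by (simp add: r_distr l_distr smult_closed m_closed smult_mult_l flip: smult_mult_r)
  then show ?case
    using ab[OF step.hyps(1)] step.IH H by (simp add: lspan_add lspan_smult)
qed

lemma lspan_l_image:
  assumes x: "x \<in> lspan R G" and G: "G \<subseteq> carrier R" and H: "H \<subseteq> carrier R"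
    and a: "a \<in> carrier R" and ab: "\<And>g. g \<in> G \<Longrightarrow> a \<otimes> g \<in> lspan R H"
  shows "a \<otimes> x \<in> lspan R H"
  using x
proof induction
  case zero
  then show ?case using a by (simp add: r_null lspan.zero)
next
  case (step g x c)
  have gx: "g \<in> carrier R" "x \<in> carrier R" using step.hyps assms lspan_closed by auto
  have "a \<otimes> (c \<odot> g \<oplus> x) = c \<odot> (a \<otimes> g) \<oplus> a \<otimes> x"
    using gx a by (simp add: r_distr smult_closed flip: smult_mult_r)
  then show ?case
    using ab[OF step.hyps(1)] step.IH H by (simp add: lspan_add lspan_smult)
qed

lemma lspan_r_image:
  assumes x: "x \<in> lspan R G" and G: "G \<subseteq> carrier R" and H: "H \<subseteq> carrier R"
    and b: "b \<in> carrier R" and ab: "\<And>g. g \<in> G \<Longrightarrow> g \<otimes> b \<in> lspan R H"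
  shows "x \<otimes> b \<in> lspan R H"
  using x
proof induction
  case zero
  then show ?case using b by (simp add: l_null lspan.zero)
next
  case (step g x c)
  have gx: "g \<in> carrier R" "x \<in> carrier R" using step.hyps assms lspan_closed by auto
  have "(c \<odot> g \<oplus> x) \<otimes> b = c \<odot> (g \<otimes> b) \<oplus> x \<otimes> b"
    using gx b by (simp add: l_distr smult_closed smult_mult_l)
  then show ?case
    using ab[OF step.hyps(1)] step.IH H by (simp add: lspan_add lspan_smult)
qed

lemma lspan_mult:
  assumes x: "x \<in> lspan R G" and y: "y \<in> lspan R H"
    and c: "G \<subseteq> carrier R" "H \<subseteq> carrier R" "K \<subseteq> carrier R"
    and gh: "\<And>g h. g \<in> G \<Longrightarrow> h \<in> H \<Longrightarrow> g \<otimes> h \<in> lspan R K"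
  shows "x \<otimes> y \<in> lspan R K"
  using x c(1,3) lspan_closed[OF y c(2)]
proof (rule lspan_r_image)
  show "g \<otimes> y \<in> lspan R K" if "g \<in> G" for g
    using y c(2,3) _ gh[OF that] by (rule lspan_l_image) (use that c in auto)
qed

lemma lspan_eq_zero:
  assumes "x \<in> lspan R G" "G \<subseteq> {\<zero>}"
  shows "x = \<zero>"
  using assms by induction (auto simp: smult_zero)

lemma lspan_insertE:
  assumes "x \<in> lspan R (insert g G)" and c: "g \<in> carrier R" "G \<subseteq> carrier R"
  obtains a x' where "x' \<in> lspan R G" "x = a \<odot> g \<oplus> x'"
proof -
  have "\<exists>a. \<exists>x'\<in>lspan R G. x = a \<odot> g \<oplus> x'"
    using assms(1)
  proof induction
    case zero
    show ?case
      by (rule exI[of _ 0], rule bexI[of _ \<zero>]) (use c in \<open>auto simp: zero_smult lspan.zero\<close>)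
  next
    case (step h x d)
    then obtain a x' where x': "x' \<in> lspan R G" "x = a \<odot> g \<oplus> x'" by blast
    have xc: "x' \<in> carrier R" "h \<in> carrier R" using x' c step.hyps lspan_closed by auto
    show ?case
    proof (cases "h = g")
      case True
      then have "d \<odot> h \<oplus> x = (d + a) \<odot> g \<oplus> x'"
        using x' xc c by (simp add: smult_l_distr a_assoc smult_closed)
      then show ?thesis using x' by blast
    next
      case False
      then have "d \<odot> h \<oplus> x = a \<odot> g \<oplus> (d \<odot> h \<oplus> x')"
        using x' xc c by (simp add: a_ac smult_closed)
      moreover have "d \<odot> h \<oplus> x' \<in> lspan R G"
        using False step.hyps x' by (auto intro: lspan.step)
      ultimately show ?thesis by blast
    qed
  qed
  then show ?thesis using that by blast
qed

lemma lspan_UnE: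
  assumes "x \<in> lspan R (A \<union> B)" and c: "A \<subseteq> carrier R" "B \<subseteq> carrier R"
  obtains a b where "a \<in> lspan R A" "b \<in> lspan R B" "x = a \<oplus> b"
proof -
  have "\<exists>a\<in>lspan R A. \<exists>b\<in>lspan R B. x = a \<oplus> b"
    using assms(1)
  proof induction
    case zero
    show ?case by (intro bexI[of _ \<zero>] bexI[OF _ lspan.zero]) (simp_all add: lspan.zero)
  next
    case (step g x k)
    then obtain a b where ab: "a \<in> lspan R A" "b \<in> lspan R B" "x = a \<oplus> b" by blast
    have cl: "a \<in> carrier R" "b \<in> carrier R" "g \<in> carrier R"
      using ab step.hyps c lspan_closed by auto
    show ?case
    proof (cases "g \<in> A")
      case True
      have "k \<odot> g \<oplus> x = (k \<odot> g \<oplus> a) \<oplus> b"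
        using cl ab(3) by (simp add: a_assoc smult_closed)
      moreover have "k \<odot> g \<oplus> a \<in> lspan R A" using True ab(1) by (rule lspan.step)
      ultimately show ?thesis using ab(2) by blast
    next
      case False
      then have "g \<in> B" using step.hyps by blast
      have "k \<odot> g \<oplus> x = a \<oplus> (k \<odot> g \<oplus> b)"
        using cl ab(3) by (simp add: a_lcomm smult_closed)
      moreover have "k \<odot> g \<oplus> b \<in> lspan R B" using \<open>g \<in> B\<close> ab(2) by (rule lspan.step)
      ultimately show ?thesis using ab(1) by blast
    qed
  qed
  then show ?thesis using that by blast
qed

lemma lspan_finite_subset:
  assumes "x \<in> lspan R G"
  obtains H where "finite H" "H \<subseteq> G" "x \<in> lspan R H"
proof -
  have "\<exists>H. finite H \<and> H \<subseteq> G \<and> x \<in> lspan R H"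
    using assms
  proof induction
    case zero
    show ?case by (intro exI[of _ "{}"]) (simp add: lspan.zero)
  next
    case (step g x c)
    then obtain H where "finite H" "H \<subseteq> G" "x \<in> lspan R H" by blast
    then show ?case
      using step.hyps lspan_mono[of H "insert g H" R]
      by (intro exI[of _ "insert g H"]) (auto intro!: lspan.step)
  qed
  then show ?thesis using that by blast
qed

text \<open>The idempotents are local units: one finite sum of them fixes all generators occurring
  in \<open>x\<close>, and the same sum annihilates \<open>x\<close> term by term. It is used with
  the vertices, and with the idempotents \<open>X e Y e\<close> of the arcs leaving one
  vertex.\<close>

lemma lspan_orthogonal_eq_zero:
  assumes x: "x \<in> lspan R G" and G: "G \<subseteq> carrier R" and \<epsilon>: "\<And>i. i \<in> I \<Longrightarrow> \<epsilon> i \<in> carrier R"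
    and orth: "\<And>i j. i \<in> I \<Longrightarrow> j \<in> I \<Longrightarrow> \<epsilon> i \<otimes> \<epsilon> j = (if i = j then \<epsilon> i else \<zero>)"
    and unit: "\<And>g. g \<in> G \<Longrightarrow> \<exists>i\<in>I. g \<otimes> \<epsilon> i = g"
    and null: "\<And>i. i \<in> I \<Longrightarrow> x \<otimes> \<epsilon> i = \<zero>"
  shows "x = \<zero>"
proof -
  define \<kappa> where "\<kappa> F = (\<Oplus>i\<in>F. \<epsilon> i)" for F
  have \<kappa>_closed: "\<kappa> F \<in> carrier R" if "F \<subseteq> I" for F
    unfolding \<kappa>_def using that \<epsilon> by (intro finsum_closed) auto
  have \<epsilon>\<kappa>: "\<epsilon> i \<otimes> \<kappa> F = \<epsilon> i" if "finite F" "F \<subseteq> I" "i \<in> F" for i F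
  proof -
    have "\<epsilon> i \<otimes> \<kappa> F = (\<Oplus>j\<in>F. \<epsilon> i \<otimes> \<epsilon> j)"
      unfolding \<kappa>_def using that \<epsilon> by (intro finsum_rdistr) auto
    also have "\<dots> = (\<Oplus>j\<in>F. if i = j then \<epsilon> j else \<zero>)"
      using that \<epsilon> by (intro finsum_cong') (auto simp: orth subset_iff)
    also have "\<dots> = \<epsilon> i"
      using that \<epsilon> by (intro add.finprod_singleton) auto
    finally show ?thesis .
  qed
  have "\<exists>F. finite F \<and> F \<subseteq> I \<and> x \<otimes> \<kappa> F = x"
    using x
  proof induction
    case zero
    show ?case by (intro exI[of _ "{}"]) (simp add: \<kappa>_def l_null)
  next
    case (step g x c)
    then obtain F where F: "finite F" "F \<subseteq> I" "x \<otimes> \<kappa> F = x" by blast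
    obtain i where i: "i \<in> I" "g \<otimes> \<epsilon> i = g" using unit step.hyps by blast
    have gx: "g \<in> carrier R" "x \<in> carrier R" using step.hyps G lspan_closed by auto
    let ?F = "insert i F"
    have F': "finite ?F" "?F \<subseteq> I" "\<kappa> ?F \<in> carrier R" "\<kappa> F \<in> carrier R"
      using F i \<kappa>_closed by auto
    have "g \<otimes> \<kappa> ?F = g \<otimes> (\<epsilon> i \<otimes> \<kappa> ?F)"
      using gx F' i \<epsilon> by (simp flip: m_assoc)
    then have g: "g \<otimes> \<kappa> ?F = g" using \<epsilon>\<kappa>[OF F'(1,2), of i] i by simp
    \<comment> \<open>The larger sum absorbs the old one, so \<open>x\<close> stays fixed when
      \<open>i\<close> is added.\<close>
    have "\<kappa> F \<otimes> \<kappa> ?F = (\<Oplus>j\<in>F. \<epsilon> j \<otimes> \<kappa> ?F)"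
      unfolding \<kappa>_def[of F] using F F' \<epsilon> by (intro finsum_ldistr) auto
    also have "\<dots> = \<kappa> F"
      unfolding \<kappa>_def[of F] using F F' \<epsilon> \<epsilon>\<kappa>[OF F'(1,2)] by (intro finsum_cong') auto
    finally have "x \<otimes> \<kappa> F \<otimes> \<kappa> ?F = x \<otimes> \<kappa> F" using gx F' by (simp add: m_assoc)
    then have "x \<otimes> \<kappa> ?F = x" by (simp add: F(3))
    then have "(c \<odot> g \<oplus> x) \<otimes> \<kappa> ?F = c \<odot> g \<oplus> x"
      using gx F' g by (simp add: l_distr smult_closed flip: smult_mult_l)
    then show ?case using F' by blast
  qed
  then obtain F where F: "finite F" "F \<subseteq> I" "x \<otimes> \<kappa> F = x" by blast
  have "x \<otimes> \<kappa> F = (\<Oplus>i\<in>F. x \<otimes> \<epsilon> i)"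
    unfolding \<kappa>_def using F \<epsilon> lspan_closed[OF x G] by (intro finsum_rdistr) auto
  also have "\<dots> = (\<Oplus>i\<in>F. \<zero>)"
    using F null by (intro finsum_cong') auto
  finally show ?thesis using F by simp
qed

text \<open>By induction on the spanning set: subtracting from each term of the sequence a multiple of
  a later one removes a generator.\<close>

lemma sequence_in_finite_lspan:
  fixes w :: "nat \<Rightarrow> 'a"
  assumes "finite G" "G \<subseteq> carrier R" "\<And>i. w i \<in> lspan R G"
  shows "\<exists>m. w m \<in> lspan R (w ` {m<..})"
  using assms
proof (induction G arbitrary: w rule: finite_induct)
  case empty
  have "w 0 = \<zero>" using empty(2)[of 0] by (rule lspan_eq_zero) simp
  then show ?case by (intro exI[of _ 0]) (simp add: lspan.zero)
next
  case (insert g G)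
  have "\<exists>a. \<exists>x'\<in>lspan R G. w i = a \<odot> g \<oplus> x'" for i
    using lspan_insertE[OF insert.prems(2)[of i]] insert.prems(1) by (metis insert_subset)
  then obtain a w' where w': "\<And>i. w' i \<in> lspan R G" "\<And>i. w i = a i \<odot> g \<oplus> w' i" by metis
  have c: "g \<in> carrier R" "G \<subseteq> carrier R" "w' i \<in> carrier R" for i
    using insert.prems(1) lspan_closed[OF w'(1)] by auto
  have wc: "w i \<in> carrier R" for i using w' c by (simp add: smult_closed)
  then have wc': "w ` A \<subseteq> carrier R" for A by auto
  show ?case
  proof (cases "\<exists>M. \<forall>i\<ge>M. a i = 0")
    case True
    \<comment> \<open>From \<open>M\<close> on the sequence avoids \<open>g\<close>. Passing to this
      tail is harmless, since the claim compares a term with later ones only.\<close>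
    then obtain M where M: "\<And>i. i \<ge> M \<Longrightarrow> a i = 0" by blast
    have "w (M + i) \<in> lspan R G" for i
      using w'(1)[of "M + i"] w'(2)[of "M + i"] M[of "M + i"] c by (simp add: zero_smult)
    then have "\<exists>m. w (M + m) \<in> lspan R ((\<lambda>i. w (M + i)) ` {m<..})"
      by (rule insert.IH[OF c(2)])
    then obtain m where "w (M + m) \<in> lspan R ((\<lambda>i. w (M + i)) ` {m<..})" by blast
    moreover have "(\<lambda>i. w (M + i)) ` {m<..} \<subseteq> w ` {M + m<..}" by auto
    ultimately have "w (M + m) \<in> lspan R (w ` {M + m<..})" using lspan_mono[THEN subsetD] by metis
    then show ?thesis by blast
  next
    case False
    then have "\<exists>j>i. a j \<noteq> 0" for i by (metis Suc_le_lessD)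
    then obtain j where j: "\<And>i. j i > i" "\<And>i. a (j i) \<noteq> 0" by metis
    \<comment> \<open>\<open>d i\<close> cancels the coefficient of \<open>g\<close> in
      \<open>w i\<close> against that of the later term \<open>w (j i)\<close>, so the sequence
      \<open>v\<close> lies in the span of \<open>G\<close>.\<close>
    define d where "d i = - (a i / a (j i))" for i
    define v where "v i = w i \<oplus> d i \<odot> w (j i)" for i
    have "v i = w' i \<oplus> d i \<odot> w' (j i)" for i
    proof -
      have "d i * a (j i) = - a i" using j by (simp add: d_def)
      then have "v i = (a i \<odot> g \<oplus> w' i) \<oplus> ((- a i) \<odot> g \<oplus> d i \<odot> w' (j i))"
        using c by (simp add: v_def w'(2) smult_r_distr smult_closed flip: smult_assoc)
      also have "\<dots> = (a i \<odot> g \<oplus> (- a i) \<odot> g) \<oplus> (w' i \<oplus> d i \<odot> w' (j i))"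
        using c by (simp add: a_ac smult_closed)
      also have "a i \<odot> g \<oplus> (- a i) \<odot> g = \<zero>"
        using c smult_l_distr[of g "a i" "- a i"] by (simp add: zero_smult)
      finally show ?thesis using c by (simp add: smult_closed)
    qed
    then have "v i \<in> lspan R G" for i
      using w'(1) c(2) by (simp add: lspan_add lspan_smult)
    then have "\<exists>m. v m \<in> lspan R (v ` {m<..})" by (rule insert.IH[OF c(2)])
    then obtain m where m: "v m \<in> lspan R (v ` {m<..})" by blast
    have "v ` {m<..} \<subseteq> lspan R (w ` {m<..})"
    proof
      fix x assume "x \<in> v ` {m<..}"
      then obtain i where i: "i > m" "x = v i" by auto
      moreover have "j i > m" using i j(1)[of i] by linarith
      ultimately show "x \<in> lspan R (w ` {m<..})"
        unfolding i(2) v_def using i(1) by (intro lspan_add lspan_smult lspan_base wc') auto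
    qed
    from lspan_subset_lspan[OF this wc'] m have "v m \<in> lspan R (w ` {m<..})" by (rule subsetD)
    moreover have "w (j m) \<in> lspan R (w ` {m<..})"
      using j(1)[of m] by (intro lspan_base wc') auto
    moreover have "w m = v m \<oplus> (- d m) \<odot> w (j m)"
    proof -
      have "d m \<odot> w (j m) \<oplus> (- d m) \<odot> w (j m) = \<zero>"
        using wc smult_l_distr[of "w (j m)" "d m" "- d m"] by (simp add: zero_smult)
      then show ?thesis using wc by (simp add: v_def a_assoc smult_closed)
    qed
    ultimately have "w m \<in> lspan R (w ` {m<..})"
      using wc' by (simp add: lspan_add lspan_smult)
    then show ?thesis by blast
  qed
qed

end

section \<open>Paths and closed paths\<close>

context wf_digraph
begin

lemma awalk_append_cancel: "awalk u p v \<Longrightarrow> awalk u (p @ q) w \<Longrightarrow> awalk v q w"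
  by (auto elim!: awalkE')

text \<open>The vertices that do not reach \<open>w\<close> form a hereditary and saturated set; it
  misses \<open>w\<close>, so it is empty.\<close>

lemma reaches_closed_path:
  assumes trivial: "\<And>S. S \<subseteq> verts G \<Longrightarrow> hereditary G S \<Longrightarrow> saturated G S \<Longrightarrow> S = {} \<or> S = verts G"
    and c: "awalk w c w" "c \<noteq> []" and v: "v \<in> verts G"
  shows "\<exists>p. awalk v p w"
proof -
  define S where "S = {v \<in> verts G. \<nexists>p. awalk v p w}"
  have step: "tail G e \<notin> S" if "e \<in> arcs G" "head G e \<notin> S" for e
    using that awalk_Cons_iff[of "tail G e" e _ w] by (auto simp: S_def)
  have "hereditary G S" using step by (auto simp: hereditary_def)
  moreover have "saturated G S"
    unfolding saturated_def
  proof (intro allI impI)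
    fix v assume v: "finite_emitter G v" "head G ` out_arcs G v \<subseteq> S"
    have "\<not> awalk v (e # p) w" for e p
    proof
      assume "awalk v (e # p) w"
      then have e: "e \<in> out_arcs G v" and p: "awalk (head G e) p w" by (auto simp: awalk_simps)
      have "head G e \<in> S" using v(2) e by blast
      then show False using p by (auto simp: S_def)
    qed
    \<comment> \<open>\<open>w\<close> reaches itself by the empty walk and would break saturation;
      but the first arc of \<open>c\<close> leaves \<open>w\<close> towards a vertex that reaches
      \<open>w\<close>.\<close>
    moreover have "v \<noteq> w" using calculation c by (cases c) auto
    ultimately have "\<nexists>p. awalk v p w" by (metis awalk_Nil_iff neq_Nil_conv)
    then show "v \<in> S" using v(1) by (simp add: S_def finite_emitter_def)
  qed
  ultimately have "S = {} \<or> S = verts G" by (intro trivial) (auto simp: S_def)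
  moreover have "w \<in> verts G" "w \<notin> S" using c by (auto simp: S_def awalk_hd_in_verts)
  ultimately show ?thesis using v by (auto simp: S_def)
qed

text \<open>A \<open>cycle\<close> has distinct heads, whereas \<open>simple_closed_path\<close>
  asks for distinct tails. Around a closed walk heads and tails form the same set, and a list whose
  set has as many elements as the list has entries is distinct.\<close>

lemma simple_closed_path_exists:
  assumes "closed_w p"
  obtains w c where "awalk w c w" "c \<noteq> []" "distinct (map (tail G) c)" "simple_closed_path G c"
proof -
  obtain c w where c: "awalk w c w" "distinct (tl (awalk_verts w c))" "c \<noteq> []"
    using closed_w_imp_cycle[OF assms] by (auto simp: cycle_def)
  have heads: "awalk_verts w c = w # map (head G) c"
    using c awalk_verts_conv'[of w c w] by (cases c) (auto simp: awalk_def)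
  have "head G (last c) = w" using c awlast_of_awalk by (auto simp: awalk_verts_conv)
  moreover have "tail G (hd c) = w" using c by (cases c) (auto simp: awalk_simps)
  ultimately have w: "w \<in> set (map (head G) c)" "w \<in> set (map (tail G) c)"
    unfolding set_map using c(3) by (metis imageI last_in_set, metis imageI hd_in_set)
  have "awalk_verts w c = map (tail G) c @ [w]"
    using c(3) \<open>head G (last c) = w\<close> by (simp add: awalk_verts_conv)
  with heads have "set (w # map (head G) c) = set (map (tail G) c @ [w])" by simp
  then have "set (map (head G) c) = set (map (tail G) c)"
    using w by (simp add: insert_absorb del: set_map)
  moreover have "distinct (map (head G) c)" using c heads by simp
  ultimately have "card (set (map (tail G) c)) = length (map (tail G) c)"
    using distinct_card[of "map (head G) c"] by (simp del: set_map)
  then have "distinct (map (tail G) c)" by (rule card_distinct)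
  then show ?thesis using that c by (auto simp: simple_closed_path_def closed_w_def)
qed

end

section \<open>Algebras generated by a Leavitt family\<close>

text \<open>Isolates what the sufficiency and the acyclic case take from the universal algebra: the
  relations, nonzero vertices, and generation by the symbols in the form of an induction rule.
  Negation is missing from \<open>generated\<close> because it is scaling by -1.\<close>

locale leavitt_algebra = nonunital_algebra R + wf_digraph E
  for R :: "('k::field,'a,'m) module_scheme" (structure) and E :: "('v,'e) pre_digraph" +
  fixes P :: "'v \<Rightarrow> 'a" and X Y :: "'e \<Rightarrow> 'a"
  assumes family: "leavitt_family E R P X Y"
    and P_nonzero: "v \<in> verts E \<Longrightarrow> P v \<noteq> \<zero>"
    and generated: "\<lbrakk>P ` verts E \<subseteq> S; X ` arcs E \<subseteq> S; Y ` arcs E \<subseteq> S; \<zero> \<in> S;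
      \<And>x y. x \<in> S \<Longrightarrow> y \<in> S \<Longrightarrow> x \<oplus> y \<in> S; \<And>x y. x \<in> S \<Longrightarrow> y \<in> S \<Longrightarrow> x \<otimes> y \<in> S;
      \<And>c x. x \<in> S \<Longrightarrow> c \<odot> x \<in> S\<rbrakk> \<Longrightarrow> carrier R \<subseteq> S"
begin

lemma generators_closed:
  "v \<in> verts E \<Longrightarrow> P v \<in> carrier R" "e \<in> arcs E \<Longrightarrow> X e \<in> carrier R"
  "e \<in> arcs E \<Longrightarrow> Y e \<in> carrier R"
  using family by (auto simp: leavitt_family_def)

lemma P_P: "v \<in> verts E \<Longrightarrow> P v \<otimes> P v = P v"
  and P_P_orth: "v \<in> verts E \<Longrightarrow> w \<in> verts E \<Longrightarrow> v \<noteq> w \<Longrightarrow> P v \<otimes> P w = \<zero>"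
  and P_X: "e \<in> arcs E \<Longrightarrow> P (tail E e) \<otimes> X e = X e"
  and X_P: "e \<in> arcs E \<Longrightarrow> X e \<otimes> P (head E e) = X e"
  and P_Y: "e \<in> arcs E \<Longrightarrow> P (head E e) \<otimes> Y e = Y e"
  and Y_P: "e \<in> arcs E \<Longrightarrow> Y e \<otimes> P (tail E e) = Y e"
  and Y_X: "e \<in> arcs E \<Longrightarrow> Y e \<otimes> X e = P (head E e)"
  and Y_X_orth: "e \<in> arcs E \<Longrightarrow> f \<in> arcs E \<Longrightarrow> e \<noteq> f \<Longrightarrow> Y e \<otimes> X f = \<zero>"
  and P_emitter: "finite_emitter E v \<Longrightarrow> P v = (\<Oplus>e\<in>out_arcs E v. X e \<otimes> Y e)"
  using family by (auto simp: leavitt_family_def)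

text \<open>\<open>pth u p\<close> and \<open>gh u p\<close> are the elements $p$ and $p^*$ of a path $p$ starting at \<open>u\<close>; the
  argument \<open>u\<close> matters only if \<open>p\<close> is empty.\<close>

primrec pth :: "'v \<Rightarrow> 'e list \<Rightarrow> 'a" where
  "pth v [] = P v"
| "pth v (e # p) = X e \<otimes> pth (head E e) p"

primrec gh :: "'v \<Rightarrow> 'e list \<Rightarrow> 'a" where
  "gh v [] = P v"
| "gh v (e # p) = gh (head E e) p \<otimes> Y e"

lemma pth_closed: "awalk u p v \<Longrightarrow> pth u p \<in> carrier R"
  by (induction p arbitrary: u) (auto simp: awalk_simps generators_closed m_closed)

lemma gh_closed: "awalk u p v \<Longrightarrow> gh u p \<in> carrier R"
  by (induction p arbitrary: u) (auto simp: awalk_simps generators_closed m_closed)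

lemmas closed = generators_closed pth_closed gh_closed m_closed

lemma P_pth: "awalk u p v \<Longrightarrow> P u \<otimes> pth u p = pth u p"
  by (cases p) (auto simp: awalk_simps P_P P_X closed simp flip: m_assoc)

lemma gh_P: "awalk u p v \<Longrightarrow> gh u p \<otimes> P u = gh u p"
  by (cases p) (auto simp: awalk_simps P_P Y_P closed m_assoc)

lemma pth_P: "awalk u p v \<Longrightarrow> pth u p \<otimes> P v = pth u p"
  by (induction p arbitrary: u) (auto simp: awalk_simps P_P m_assoc closed awalk_last_in_verts)

lemma P_gh: "awalk u p v \<Longrightarrow> P v \<otimes> gh u p = gh u p"
  by (induction p arbitrary: u)
    (auto simp: awalk_simps P_P closed awalk_last_in_verts simp flip: m_assoc)

lemma P_pth_orth:
  assumes "awalk u p v" "w \<in> verts E" "w \<noteq> u"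
  shows "P w \<otimes> pth u p = \<zero>"
proof -
  have "P w \<otimes> pth u p = P w \<otimes> P u \<otimes> pth u p"
    using assms P_pth[OF assms(1)] by (simp add: m_assoc closed awalk_hd_in_verts)
  then show ?thesis
    using assms P_P_orth[of w u] by (simp add: awalk_hd_in_verts l_null closed)
qed

lemma pth_P_orth:
  assumes "awalk u p v" "w \<in> verts E" "w \<noteq> v"
  shows "pth u p \<otimes> P w = \<zero>"
proof -
  have "pth u p \<otimes> P w = pth u p \<otimes> (P v \<otimes> P w)"
    using assms pth_P[OF assms(1)]
    by (simp add: closed awalk_last_in_verts flip: m_assoc)
  then show ?thesis
    using assms P_P_orth[of v w] by (simp add: awalk_last_in_verts r_null closed)
qed

lemma gh_P_orth:
  assumes "awalk u p v" "w \<in> verts E" "w \<noteq> u"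
  shows "gh u p \<otimes> P w = \<zero>"
proof -
  have "gh u p \<otimes> P w = gh u p \<otimes> (P u \<otimes> P w)"
    using assms gh_P[OF assms(1)]
    by (simp add: closed awalk_hd_in_verts flip: m_assoc)
  then show ?thesis
    using assms P_P_orth[of u w] by (simp add: awalk_hd_in_verts r_null closed)
qed

lemma pth_append: "awalk u p v \<Longrightarrow> awalk v q w \<Longrightarrow> pth u (p @ q) = pth u p \<otimes> pth v q"
  by (induction p arbitrary: u) (auto simp: awalk_simps P_pth m_assoc closed)

lemma gh_append: "awalk u p v \<Longrightarrow> awalk v q w \<Longrightarrow> gh u (p @ q) = gh v q \<otimes> gh u p"
  by (induction p arbitrary: u) (auto simp: awalk_simps gh_P m_assoc closed)

lemma gh_pth: "awalk u p v \<Longrightarrow> gh u p \<otimes> pth u p = P v"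
proof (induction p arbitrary: u)
  case (Cons e p)
  then have e: "e \<in> arcs E" "awalk (head E e) p v" by (auto simp: awalk_simps)
  have "gh u (e # p) \<otimes> pth u (e # p) = gh (head E e) p \<otimes> ((Y e \<otimes> X e) \<otimes> pth (head E e) p)"
    using e by (simp add: m_assoc closed)
  also have "\<dots> = P v" using e Cons.IH[OF e(2)] by (simp add: Y_X P_pth)
  finally show ?case .
qed (auto simp: awalk_simps P_P)

lemma gh_pth_prefix: "awalk u p v \<Longrightarrow> awalk v r w \<Longrightarrow> gh u p \<otimes> pth u (p @ r) = pth v r"
  using gh_pth[of u p v]
  by (simp add: pth_append[of u p v r w] closed P_pth flip: m_assoc)

lemma gh_prefix_pth: "awalk u p v \<Longrightarrow> awalk v r w \<Longrightarrow> gh u (p @ r) \<otimes> pth u p = gh v r"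
  using gh_pth[of u p v]
  by (simp add: gh_append[of u p v r w] closed gh_P m_assoc)

text \<open>The innermost factor \<open>Y e X f\<close> collapses to a vertex as long as the arcs
  agree and to zero at the first disagreement, which incomparability forces. Different starting
  vertices already separate the first arcs, or are orthogonal themselves when a walk is
  empty.\<close>

lemma gh_pth_orth:
  assumes "awalk u p v" "awalk u' q w" "u \<noteq> u' \<or> (\<not> prefix p q \<and> \<not> prefix q p)"
  shows "gh u p \<otimes> pth u' q = \<zero>"
  using assms
proof (induction p arbitrary: u u' q)
  case Nil
  then show ?case by (auto simp: awalk_simps intro: P_pth_orth)
next
  case (Cons e p)
  then have e: "e \<in> arcs E" "awalk (head E e) p v" "u = tail E e" by (auto simp: awalk_simps)
  show ?case
  proof (cases q)
    case Nil
    then show ?thesis using Cons.prems gh_P_orth[OF Cons.prems(1)] by (auto simp: awalk_simps)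
  next
    case (Cons f r)
    with Cons.prems have f: "f \<in> arcs E" "awalk (head E f) r w" "u' = tail E f"
      by (auto simp: awalk_simps)
    have *: "gh u (e # p) \<otimes> pth u' q = gh (head E e) p \<otimes> ((Y e \<otimes> X f) \<otimes> pth (head E f) r)"
      using e f Cons by (simp add: m_assoc closed)
    show ?thesis
    proof (cases "e = f")
      case True
      then have "gh (head E e) p \<otimes> pth (head E e) r = \<zero>"
        using e f Cons Cons.prems by (intro Cons.IH) auto
      then show ?thesis using * e f True by (simp add: Y_X P_pth)
    next
      case False
      then show ?thesis using * e f by (simp add: Y_X_orth l_null r_null closed)
    qed
  qed
qed

section \<open>Monomials p q^* and the subalgebras they span\<close>

definition monomials :: "'v set \<Rightarrow> 'e set \<Rightarrow> 'a set" where
  "monomials W F = {pth u p \<otimes> gh u' q | u p u' q z. awalk u p z \<and> awalk u' q z \<and>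
     set p \<union> set q \<subseteq> F \<and> u \<in> W \<and> u' \<in> W}"

lemma monomials_closed: "monomials W F \<subseteq> carrier R"
  by (auto simp: monomials_def intro!: closed)

lemma monomialsI:
  "\<lbrakk>awalk u p z; awalk u' q z; set p \<subseteq> F; set q \<subseteq> F; u \<in> W; u' \<in> W\<rbrakk>
    \<Longrightarrow> pth u p \<otimes> gh u' q \<in> monomials W F"
  unfolding monomials_def by blast

lemma monomials_mono: "W \<subseteq> W' \<Longrightarrow> F \<subseteq> F' \<Longrightarrow> monomials W F \<subseteq> monomials W' F'"
  unfolding monomials_def by blast

text \<open>Everything depends on the middle factor \<open>q^* r\<close>: it vanishes unless one of
  \<open>q\<close>, \<open>r\<close> is a prefix of the other, and then it is a path or a ghost
  path. The outer starting vertices survive, so a bound \<open>W\<close> on starting vertices and a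
  bound \<open>F\<close> on arcs together cut out a subalgebra.\<close>

lemma monomials_mult:
  assumes "g \<in> monomials W F" "h \<in> monomials W F"
  shows "g \<otimes> h \<in> lspan R (monomials W F)"
proof -
  obtain u p u' q z where g: "g = pth u p \<otimes> gh u' q" "awalk u p z" "awalk u' q z"
    "set p \<subseteq> F" "set q \<subseteq> F" "u \<in> W" "u' \<in> W"
    using assms(1) by (auto simp: monomials_def)
  obtain s r s' t y where h: "h = pth s r \<otimes> gh s' t" "awalk s r y" "awalk s' t y"
    "set r \<subseteq> F" "set t \<subseteq> F" "s \<in> W" "s' \<in> W"
    using assms(2) by (auto simp: monomials_def)
  have gh: "g \<otimes> h = pth u p \<otimes> ((gh u' q \<otimes> pth s r) \<otimes> gh s' t)"
    using g h by (simp add: m_assoc closed)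
  consider "u' \<noteq> s \<or> (\<not> prefix q r \<and> \<not> prefix r q)" | r' where "u' = s" "r = q @ r'"
    | q' where "u' = s" "q = r @ q'"
    by (auto simp: prefix_def)
  then have "g \<otimes> h = \<zero> \<or> g \<otimes> h \<in> monomials W F"
  proof cases
    case 1
    then have "gh u' q \<otimes> pth s r = \<zero>" by (rule gh_pth_orth[OF g(3) h(2)])
    then show ?thesis
      unfolding gh using pth_closed[OF g(2)] gh_closed[OF h(3)] by (simp add: l_null r_null)
  next
    case 2
    have r': "awalk z r' y"
      using awalk_append_cancel[OF g(3)] h(2) unfolding 2 by blast
    have "g \<otimes> h = pth u p \<otimes> (pth z r' \<otimes> gh s' t)"
      unfolding gh using gh_pth_prefix[OF g(3) r'] by (simp only: 2)
    also have "\<dots> = pth u (p @ r') \<otimes> gh s' t"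
      using pth_closed[OF g(2)] pth_closed[OF r'] gh_closed[OF h(3)]
      by (simp add: pth_append[OF g(2) r'] m_assoc)
    finally have "g \<otimes> h = pth u (p @ r') \<otimes> gh s' t" .
    moreover have "awalk u (p @ r') y" using g(2) r' by (rule awalk_appendI)
    ultimately have "g \<otimes> h \<in> monomials W F"
      using g(4,6) h(3,4,5,7) by (simp add: monomialsI 2 del: awalk_append_iff)
    then show ?thesis ..
  next
    case 3
    have q': "awalk y q' z"
      using awalk_append_cancel[OF h(2)] g(3) unfolding 3 by blast
    have "g \<otimes> h = pth u p \<otimes> (gh y q' \<otimes> gh s' t)"
      unfolding gh using gh_prefix_pth[OF h(2) q'] by (simp only: 3)
    also have "\<dots> = pth u p \<otimes> gh s' (t @ q')"
      by (simp add: gh_append[OF h(3) q'])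
    finally have "g \<otimes> h = pth u p \<otimes> gh s' (t @ q')" .
    moreover have "awalk s' (t @ q') z" using h(3) q' by (rule awalk_appendI)
    ultimately have "g \<otimes> h \<in> monomials W F"
      using g(2,4,5,6) h(5,7) by (simp add: monomialsI 3 del: awalk_append_iff)
    then show ?thesis ..
  qed
  then show ?thesis
    using lspan.zero lspan_base[OF _ monomials_closed] by metis
qed

lemma lspan_monomials_mult:
  "x \<in> lspan R (monomials W F) \<Longrightarrow> y \<in> lspan R (monomials W F) \<Longrightarrow>
    x \<otimes> y \<in> lspan R (monomials W F)"
  using monomials_closed monomials_mult by (blast intro: lspan_mult)

lemma carrier_eq_lspan: "carrier R = lspan R (monomials (verts E) (arcs E))"
proof
  have base: "pth u p \<otimes> gh u' q \<in> lspan R (monomials (verts E) (arcs E))"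
    if "awalk u p z" "awalk u' q z" for u p u' q z
    using that by (auto intro!: lspan_base monomials_closed monomialsI[of u p z u' q])
  show "carrier R \<subseteq> lspan R (monomials (verts E) (arcs E))"
  proof (rule generated)
    show "P ` verts E \<subseteq> lspan R (monomials (verts E) (arcs E))"
    proof
      fix x assume "x \<in> P ` verts E"
      then obtain v where v: "v \<in> verts E" "x = pth v [] \<otimes> gh v []" by (auto simp: P_P)
      show "x \<in> lspan R (monomials (verts E) (arcs E))"
        unfolding v(2) using v(1) by (intro base[where z = v]) (auto simp: awalk_simps)
    qed
    show "X ` arcs E \<subseteq> lspan R (monomials (verts E) (arcs E))"
    proof
      fix x assume "x \<in> X ` arcs E"
      then obtain e where e: "e \<in> arcs E" "x = pth (tail E e) [e] \<otimes> gh (head E e) []"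
        by (auto simp: X_P m_assoc P_P closed)
      show "x \<in> lspan R (monomials (verts E) (arcs E))"
        unfolding e(2) using e(1) by (intro base[where z = "head E e"]) (auto simp: awalk_simps)
    qed
    show "Y ` arcs E \<subseteq> lspan R (monomials (verts E) (arcs E))"
    proof
      fix x assume "x \<in> Y ` arcs E"
      then obtain e where e: "e \<in> arcs E" "x = pth (head E e) [] \<otimes> gh (tail E e) [e]"
        by (auto simp: P_Y closed)
      show "x \<in> lspan R (monomials (verts E) (arcs E))"
        unfolding e(2) using e(1) by (intro base[where z = "head E e"]) (auto simp: awalk_simps)
    qed
  qed (use monomials_closed in \<open>auto intro: lspan.zero lspan_add lspan_smult lspan_monomials_mult\<close>)
qed (use lspan_closed monomials_closed in blast)

lemma in_finite_lspan:
  assumes "x \<in> carrier R"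
  obtains W F where "finite W" "finite F" "W \<subseteq> verts E" "F \<subseteq> arcs E"
    "x \<in> lspan R (monomials W F)"
proof -
  have "\<exists>W F. finite W \<and> finite F \<and> W \<subseteq> verts E \<and> F \<subseteq> arcs E \<and> x \<in> lspan R (monomials W F)"
    using assms unfolding carrier_eq_lspan
  proof induction
    case zero
    show ?case by (intro exI[of _ "{}"]) (simp add: lspan.zero)
  next
    case (step g x c)
    then obtain W F where WF: "finite W" "finite F" "W \<subseteq> verts E" "F \<subseteq> arcs E"
      "x \<in> lspan R (monomials W F)" by blast
    obtain u p u' q z where g: "g = pth u p \<otimes> gh u' q" "awalk u p z" "awalk u' q z"
      "set p \<subseteq> arcs E" "set q \<subseteq> arcs E" "u \<in> verts E" "u' \<in> verts E"
      using step.hyps(1) by (auto simp: monomials_def)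
    let ?W = "W \<union> {u, u'}" and ?F = "F \<union> set p \<union> set q"
    have "x \<in> lspan R (monomials ?W ?F)"
      using lspan_mono[OF monomials_mono[of W ?W F ?F], of R] WF by auto
    moreover have "g \<in> monomials ?W ?F"
      using g by (auto intro!: monomialsI)
    ultimately show ?case
      using WF g by (intro exI[of _ ?W] exI[of _ ?F]) (auto intro: lspan.step)
  qed
  then show ?thesis using that by blast
qed

lemma eq_zero_if_mult_P:
  assumes "x \<in> carrier R" "\<And>v. v \<in> verts E \<Longrightarrow> x \<otimes> P v = \<zero>"
  shows "x = \<zero>"
  using assms(1)[unfolded carrier_eq_lspan]
proof (rule lspan_orthogonal_eq_zero[where \<epsilon> = P and I = "verts E"])
  show "\<exists>v\<in>verts E. g \<otimes> P v = g" if g: "g \<in> monomials (verts E) (arcs E)" for g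
  proof -
    obtain u p u' q z where "g = pth u p \<otimes> gh u' q" "awalk u p z" "awalk u' q z" "u' \<in> verts E"
      using g by (auto simp: monomials_def)
    then have "g \<otimes> P u' = g" by (simp add: m_assoc gh_P closed)
    then show ?thesis using \<open>u' \<in> verts E\<close> ..
  qed
qed (use assms monomials_closed in \<open>auto simp: closed P_P P_P_orth\<close>)

lemma path_combination_leading_term:
  assumes "finite G" "\<And>u p. (u, p) \<in> G \<Longrightarrow> awalk u p v"
    and "x \<in> lspan R ((\<lambda>(u, p). pth u p) ` G)" "x \<noteq> \<zero>"
  shows "\<exists>u p k x'. (u, p) \<in> G \<and> k \<noteq> 0 \<and> x = k \<odot> pth u p \<oplus> x' \<and>
    x' \<in> lspan R ((\<lambda>(u, p). pth u p) ` {(u', q) \<in> G. (u', q) \<noteq> (u, p) \<and> length p \<le> length q})"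
  using assms
proof (induction G arbitrary: x rule: finite_ranking_induct[where f = "length \<circ> snd"])
  case empty
  then show ?case using lspan_eq_zero[of x "{}"] by simp
next
  case (insert a G)
  obtain u p where a: "a = (u, p)" by fastforce
  show ?case
  proof (cases "a \<in> G")
    case True
    then show ?thesis using insert by (simp add: insert_absorb)
  next
    case False
    have G: "(\<lambda>(u, p). pth u p) ` G \<subseteq> carrier R" and g: "pth u p \<in> carrier R"
      using insert.prems(1) by (auto simp: a intro: closed)
    have "x \<in> lspan R (insert (pth u p) ((\<lambda>(u, p). pth u p) ` G))"
      using insert.prems(2) by (simp add: a)
    then obtain k y where y: "y \<in> lspan R ((\<lambda>(u, p). pth u p) ` G)" "x = k \<odot> pth u p \<oplus> y"
      using g G by (rule lspan_insertE)
    show ?thesis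
    proof (cases "y = \<zero>")
      case True
      then have "k \<noteq> 0" using insert.prems(3) y g by (auto simp: zero_smult)
      then show ?thesis
        using True y a by (intro exI[of _ u] exI[of _ p] exI[of _ k] exI[of _ y])
          (simp add: lspan.zero)
    next
      case False
      then obtain u' q l y' where q: "(u', q) \<in> G" "l \<noteq> 0" "y = l \<odot> pth u' q \<oplus> y'"
        and y': "y' \<in> lspan R ((\<lambda>(u, p). pth u p) `
          {(u'', r) \<in> G. (u'', r) \<noteq> (u', q) \<and> length q \<le> length r})" (is "_ \<in> lspan R (?f ` ?G)")
        using insert.IH[OF insert.prems(1) y(1) False] by auto
      have cl: "pth u' q \<in> carrier R" "y' \<in> carrier R"
        using q(1) G lspan_closed[OF y'] by auto
      have *: "x = l \<odot> pth u' q \<oplus> (k \<odot> pth u p \<oplus> y')"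
        using y(2) q(3) cl g by (simp add: a_lcomm smult_closed)
      have "k \<odot> pth u p \<oplus> y' \<in> lspan R (?f ` insert a ?G)"
        by (rule lspan.step) (use a y' lspan_mono[of "?f ` ?G" "?f ` insert a ?G" R] in auto)
      moreover have "insert a ?G \<subseteq>
        {(u'', r) \<in> insert a G. (u'', r) \<noteq> (u', q) \<and> length q \<le> length r}"
        using insert.hyps(2)[OF q(1)] a q(1) \<open>a \<notin> G\<close> by auto
      ultimately have "k \<odot> pth u p \<oplus> y' \<in> lspan R
          (?f ` {(u'', r) \<in> insert a G. (u'', r) \<noteq> (u', q) \<and> length q \<le> length r})"
        using lspan_mono[OF image_mono] by (rule_tac subsetD)
      then show ?thesis
        using q(1,2) * by (intro exI[of _ u'] exI[of _ q] exI[of _ l] exI[of _ "k \<odot> pth u p \<oplus> y'"])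
          simp
    qed
  qed
qed

text \<open>Only finitely many \<open>Y e\<close> occur in \<open>s\<close>, and
  \<open>Y e X f = 0\<close> for every other arc \<open>f\<close>. At an infinite emitter this
  leaves an arc that annihilates \<open>s\<close>.\<close>

lemma lspan_arc_avoid:
  assumes "s \<in> lspan R {z \<otimes> Y e | z e. z \<in> carrier R \<and> e \<in> out_arcs E v}"
  shows "\<exists>F. finite F \<and> (\<forall>f\<in>out_arcs E v - F. s \<otimes> X f = \<zero>)"
  using assms
proof induction
  case zero
  then show ?case by (intro exI[of _ "{}"]) (auto simp: l_null closed)
next
  case (step g x c)
  then obtain F where F: "finite F" "\<And>f. f \<in> out_arcs E v - F \<Longrightarrow> x \<otimes> X f = \<zero>" by blast
  obtain z e where g: "g = z \<otimes> Y e" "z \<in> carrier R" "e \<in> out_arcs E v" using step.hyps by blast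
  have "x \<in> carrier R" using step.hyps lspan_closed by (force intro: closed)
  then have "(c \<odot> g \<oplus> x) \<otimes> X f = \<zero>" if "f \<in> out_arcs E v - insert e F" for f
    using that g F(2)[of f]
    by (simp add: l_distr closed smult_closed m_assoc Y_X_orth r_null smult_zero flip: smult_mult_l)
      (metis Y_X_orth r_null smult_zero zero_closed l_zero)
  then show ?case using F(1) by (meson finite_insert)
qed

text \<open>Sorts the monomials \<open>p q^*\<close> with \<open>q\<close> starting at
  \<open>v\<close> by whether \<open>q\<close> is empty: if not, the ghost of its first arc is the
  rightmost factor.\<close>

lemma mult_P_decomp:
  assumes "x \<in> carrier R" and v: "v \<in> verts E"
  obtains y s where "y \<in> lspan R {pth u p | u p. awalk u p v}"
    "s \<in> lspan R {z \<otimes> Y e | z e. z \<in> carrier R \<and> e \<in> out_arcs E v}" "x \<otimes> P v = y \<oplus> s"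
proof -
  let ?A = "{pth u p | u p. awalk u p v}"
    and ?B = "{z \<otimes> Y e | z e. z \<in> carrier R \<and> e \<in> out_arcs E v}"
  have AB: "?A \<subseteq> carrier R" "?B \<subseteq> carrier R" by (auto intro: closed)
  have "x \<otimes> P v \<in> lspan R (?A \<union> ?B)"
    using assms(1)[unfolded carrier_eq_lspan] monomials_closed
  proof (rule lspan_r_image)
    fix g assume "g \<in> monomials (verts E) (arcs E)"
    then obtain u p u' q z where g: "g = pth u p \<otimes> gh u' q" "awalk u p z" "awalk u' q z"
      by (auto simp: monomials_def)
    have gP: "g \<otimes> P v = pth u p \<otimes> (gh u' q \<otimes> P v)"
      using g v by (simp add: m_assoc closed)
    have "g \<otimes> P v \<in> {\<zero>} \<union> ?A \<union> ?B"
    proof (cases "u' = v")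
      case False
      then show ?thesis using gP gh_P_orth[OF g(3) v] g(2) by (simp add: r_null closed)
    next
      case True
      then have "g \<otimes> P v = g" using gP g by (simp add: gh_P)
      moreover have "g \<in> ?A \<union> ?B"
      proof (cases q)
        case Nil
        then have "g = pth u p" "z = v" using g True by (auto simp: awalk_simps pth_P)
        then show ?thesis using g(2) by blast
      next
        case (Cons e r)
        then have e: "e \<in> out_arcs E v" "awalk (head E e) r z"
          using g(3) True by (auto simp: awalk_simps)
        then have "g = (pth u p \<otimes> gh (head E e) r) \<otimes> Y e"
          using g Cons by (simp add: m_assoc closed)
        then show ?thesis using e g(2) by (blast intro: closed)
      qed
      ultimately show ?thesis by simp
    qed
    then consider "g \<otimes> P v = \<zero>" | "g \<otimes> P v \<in> ?A \<union> ?B" by blast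
    then show "g \<otimes> P v \<in> lspan R (?A \<union> ?B)"
    proof cases
      case 2
      then show ?thesis by (rule lspan_base) (use AB in blast)
    qed (simp add: lspan.zero)
  qed (use AB v in \<open>auto simp: closed\<close>)
  then show ?thesis using lspan_UnE[OF _ AB] that by blast
qed

end

section \<open>The sufficiency of the conditions\<close>

text \<open>Simplicity of \<open>c\<close> ensures that among the prefixes of its powers only powers
  of \<open>c\<close> return to \<open>w\<close>. The walk \<open>d\<close> may be any closed walk
  at \<open>w\<close> that parts from \<open>c\<close>; Condition (L) enters through
  \<open>cd\<close>.\<close>

locale leavitt_two_loops = leavitt_algebra R E P X Y
  for R :: "('k::field,'a,'m) module_scheme" (structure) and E :: "('v,'e) pre_digraph"
    and P :: "'v \<Rightarrow> 'a" and X Y :: "'e \<Rightarrow> 'a" +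
  fixes w :: 'v and c d :: "'e list"
  assumes c: "awalk w c w" "c \<noteq> []" "distinct (map (tail E) c)"
    and d: "awalk w d w" and cd: "\<not> prefix c d" "\<not> prefix d c"
    and reach: "v \<in> verts E \<Longrightarrow> \<exists>p. awalk v p w"
begin

lemma w: "w \<in> verts E"
  using c by (simp add: awalk_hd_in_verts)

section \<open>Powers of the simple closed path and compression by them\<close>

abbreviation c_pow :: "nat \<Rightarrow> 'e list" where
  "c_pow n \<equiv> concat (replicate n c)"

lemma awalk_c_pow: "awalk w (c_pow n) w"
  by (induction n) (use c in \<open>auto simp: awalk_simps w intro!: awalk_appendI simp del: awalk_append_iff\<close>)

text \<open>A simple closed path comes back to its base only at its end, so a closed prefix consists
  of whole rounds.\<close>

lemma awalk_prefix_c_pow: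
  assumes "awalk w p w" "prefix p (c_pow n)"
  shows "\<exists>j. p = c_pow j"
  using assms
proof (induction n arbitrary: p)
  case 0
  then show ?case by (intro exI[of _ 0]) simp
next
  case (Suc n)
  from Suc.prems(2) have "prefix p c \<or> (\<exists>q. p = c @ q \<and> prefix q (c_pow n))"
    by (simp add: prefix_append)
  then consider s where "c = p @ s" | q where "p = c @ q" "prefix q (c_pow n)"
    unfolding prefix_def[of p c] by blast
  then show ?case
  proof cases
    case 1
    have "awalk w (p @ s) w" using c(1) unfolding 1 .
    with Suc.prems(1) have s: "awalk w s w" by (rule awalk_append_cancel)
    \<comment> \<open>Otherwise \<open>p\<close> and \<open>s\<close> would begin with two arcs of
      \<open>c\<close> that share the tail \<open>w\<close>.\<close>
    have "p = [] \<or> s = []"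
    proof (rule ccontr)
      assume "\<not> (p = [] \<or> s = [])"
      then obtain e p' f s' where "p = e # p'" "s = f # s'" by (meson neq_Nil_conv)
      then have "tail E e = w" "tail E f = w" "e \<in> set p" "f \<in> set s"
        using s Suc.prems(1) by (auto simp: awalk_simps)
      then show False using c(3) unfolding 1 by (auto simp: disjoint_iff)
    qed
    then show ?thesis
    proof
      assume "p = []" then show ?thesis by (intro exI[of _ 0]) simp
    next
      assume "s = []" then show ?thesis using 1 by (intro exI[of _ 1]) simp
    qed
  next
    case 2
    then obtain j where "q = c_pow j"
      using Suc.IH awalk_append_cancel[OF c(1)] Suc.prems(1) by blast
    then show ?thesis using 2 by (intro exI[of _ "Suc j"]) simp
  qed
qed

text \<open>If \<open>c\<^sup>n d\<close> were a prefix of \<open>p c\<^sup>n d\<close>, then \<open>p\<close> would be a power of \<open>c\<close>, and one of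
  \<open>c\<close>, \<open>d\<close> a prefix of the other.\<close>

lemma closed_path_annihilated:
  assumes p: "awalk w p w" "p \<noteq> []" "length p \<le> n"
  shows "gh w (c_pow n @ d) \<otimes> pth w p \<otimes> pth w (c_pow n @ d) = \<zero>"
proof -
  let ?q = "c_pow n @ d"
  have q: "awalk w ?q w" using awalk_c_pow d by (rule awalk_appendI)
  have pq: "awalk w (p @ ?q) w" using p(1) q by (rule awalk_appendI)
  have "\<not> prefix ?q (p @ ?q)"
  proof
    assume pre: "prefix ?q (p @ ?q)"
    have len: "length (c_pow n) \<ge> n"
      using c(2) by (induction n) (auto simp: Suc_le_eq neq_Nil_conv)
    have "prefix (c_pow n) (p @ ?q)" using pre append_prefixD by blast
    then have "prefix p (c_pow n)"
      using prefix_length_prefix[of p "p @ ?q" "c_pow n"] len p(3) by simp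
    then obtain j where j: "p = c_pow j" using awalk_prefix_c_pow p(1) by blast
    \<comment> \<open>A power of \<open>c\<close> commutes with \<open>c_pow n\<close>. Cancelling
      \<open>c_pow n\<close> makes \<open>d\<close> a prefix of \<open>p @ d\<close>, which also
      begins with \<open>c\<close>; two prefixes of one list are comparable.\<close>
    have "c_pow (j + n) = c_pow (n + j)" by (simp only: add.commute)
    then have comm: "p @ c_pow n = c_pow n @ p"
      by (simp only: replicate_add concat_append j)
    have "p @ ?q = c_pow n @ (p @ d)" by (simp only: comm flip: append.assoc)
    then have "prefix (c_pow n @ d) (c_pow n @ (p @ d))" using pre by (simp only:)
    then have pre_d: "prefix d (p @ d)" by (simp only: same_prefix_prefix)
    obtain j' where "j = Suc j'" using j p(2) by (cases j) auto
    then have "prefix c (p @ d)" using j by simp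
    then show False using prefix_same_cases[OF pre_d] cd by blast
  qed
  moreover have "\<not> prefix (p @ ?q) ?q"
    using p(2) prefix_length_le[of "p @ ?q" ?q] by auto
  ultimately have "gh w ?q \<otimes> pth w (p @ ?q) = \<zero>"
    by (intro gh_pth_orth[OF q pq]) simp
  then show ?thesis
    using p q by (simp add: pth_append[OF p(1) q] m_assoc closed del: awalk_append_iff)
qed

text \<open>Finitely many closed paths occur in \<open>t\<close>. With \<open>n\<close> above all
  their lengths, one compression by \<open>q = c_pow n @ d\<close> annihilates all of
  \<open>t\<close>, while \<open>q^* q = w\<close> preserves \<open>k w\<close>.\<close>

lemma vertex_from_unipotent:
  assumes t: "t \<in> lspan R {pth w p | p. awalk w p w \<and> p \<noteq> []}" and k: "k \<noteq> 0"
  shows "\<exists>a\<in>carrier R. \<exists>b\<in>carrier R. a \<otimes> (k \<odot> P w \<oplus> t) \<otimes> b = P w"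
proof -
  obtain H where H: "finite H" "H \<subseteq> pth w ` {p. awalk w p w \<and> p \<noteq> []}" "t \<in> lspan R H"
    using lspan_finite_subset[OF t[unfolded setcompr_eq_image]] .
  obtain S where S: "S \<subseteq> {p. awalk w p w \<and> p \<noteq> []}" "finite S" "H = pth w ` S"
    using finite_subset_image[OF H(1,2)] by auto
  obtain n where n: "\<And>p. p \<in> S \<Longrightarrow> length p \<le> n"
    using S(2) finite_nat_set_iff_bounded_le[of "length ` S"] by auto
  define q where "q = c_pow n @ d"
  have q: "awalk w q w" unfolding q_def using awalk_c_pow d by (rule awalk_appendI)
  have Hc: "H \<subseteq> carrier R" using S by (auto intro: closed)
  have "gh w q \<otimes> t \<otimes> pth w q \<in> lspan R {}"
    using H(3) Hc _ gh_closed[OF q] pth_closed[OF q]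
  proof (rule lspan_linear_image)
    fix g assume "g \<in> H"
    then obtain p where "p \<in> S" "g = pth w p" using S by auto
    then have "gh w q \<otimes> g \<otimes> pth w q = \<zero>"
      unfolding q_def using S n closed_path_annihilated by auto
    then show "gh w q \<otimes> g \<otimes> pth w q \<in> lspan R {}" by (simp add: lspan.zero)
  qed simp
  then have "gh w q \<otimes> t \<otimes> pth w q = \<zero>" by (rule lspan_eq_zero) simp
  moreover have "t \<in> carrier R" using H(3) Hc by (rule lspan_closed)
  ultimately have "gh w q \<otimes> (k \<odot> P w \<oplus> t) \<otimes> pth w q = k \<odot> P w"
    using q w by (simp add: r_distr l_distr closed smult_closed gh_P gh_pth
        flip: smult_mult_l smult_mult_r)
  then have "(inverse k \<odot> gh w q) \<otimes> (k \<odot> P w \<oplus> t) \<otimes> pth w q = P w"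
    using q w k \<open>t \<in> carrier R\<close>
    by (simp add: closed smult_closed smult_one flip: smult_mult_l smult_assoc)
  moreover have "inverse k \<odot> gh w q \<in> carrier R" "pth w q \<in> carrier R"
    using q by (simp_all add: closed smult_closed)
  ultimately show ?thesis by blast
qed

text \<open>Multiplying by \<open>(p @ r)^*\<close> for a shortest path \<open>p\<close> turns every
  other path, continued by \<open>r\<close>, into zero or a nontrivial closed path at
  \<open>w\<close>; no ghost arcs are left over. The walk \<open>r\<close> stays visible in the
  conclusion so that its first arc can be prescribed.\<close>

lemma vertex_from_path_combination:
  assumes x: "x \<in> lspan R {pth u p | u p. awalk u p v}" "x \<noteq> \<zero>" and r: "awalk v r w"
  shows "\<exists>a\<in>carrier R. \<exists>b\<in>carrier R. a \<otimes> x \<otimes> pth v r \<otimes> b = P w"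
proof -
  have eq: "{pth u p | u p. awalk u p v} = (\<lambda>(u, p). pth u p) ` {(u, p). awalk u p v}" by auto
  obtain H where H: "finite H" "H \<subseteq> (\<lambda>(u, p). pth u p) ` {(u, p). awalk u p v}" "x \<in> lspan R H"
    using lspan_finite_subset[OF x(1)[unfolded eq]] .
  obtain G where G: "G \<subseteq> {(u, p). awalk u p v}" "finite G" "H = (\<lambda>(u, p). pth u p) ` G"
    using finite_subset_image[OF H(1,2)] by auto
  have "\<exists>u p k x'. (u, p) \<in> G \<and> k \<noteq> 0 \<and> x = k \<odot> pth u p \<oplus> x' \<and> x' \<in> lspan R
    ((\<lambda>(u, p). pth u p) ` {(u', q) \<in> G. (u', q) \<noteq> (u, p) \<and> length p \<le> length q})"
    using path_combination_leading_term[OF G(2) _ H(3)[unfolded G(3)] x(2)] G(1) by blast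
  then obtain u p k x' where p: "(u, p) \<in> G" "k \<noteq> 0" "x = k \<odot> pth u p \<oplus> x'"
    and x': "x' \<in> lspan R ((\<lambda>(u, p). pth u p) `
      {(u', q) \<in> G. (u', q) \<noteq> (u, p) \<and> length p \<le> length q})" (is "_ \<in> lspan R ?H")
    by blast
  let ?C = "{pth w p | p. awalk w p w \<and> p \<noteq> []}"
  have aw: "awalk u p v" using G p by auto
  have pr: "awalk u (p @ r) w" using aw r by (rule awalk_appendI)
  have Hc: "?H \<subseteq> carrier R" and Cc: "?C \<subseteq> carrier R" using G by (auto intro!: closed)
  have t: "gh u (p @ r) \<otimes> x' \<otimes> pth v r \<in> lspan R ?C"
    using x' Hc Cc gh_closed[OF pr] pth_closed[OF r]
  proof (rule lspan_linear_image)
    fix g assume "g \<in> ?H"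
    then obtain u' q where q: "(u', q) \<in> G" "(u', q) \<noteq> (u, p)" "length p \<le> length q" "g = pth u' q"
      by auto
    then have q': "awalk u' q v" using G by auto
    then have qr: "awalk u' (q @ r) w" using r by (rule awalk_appendI)
    have eq: "gh u (p @ r) \<otimes> g \<otimes> pth v r = gh u (p @ r) \<otimes> pth u' (q @ r)"
      using pth_closed[OF q'] gh_closed[OF pr] pth_closed[OF r]
      by (simp add: q(4) pth_append[OF q' r] m_assoc)
    show "gh u (p @ r) \<otimes> g \<otimes> pth v r \<in> lspan R ?C"
    proof (cases "u = u' \<and> prefix (p @ r) (q @ r)")
      case True
      then obtain s where s: "q @ r = (p @ r) @ s" "u = u'" by (auto simp: prefix_def)
      have "s \<noteq> []" using s q(2) by auto
      moreover have sw: "awalk w s w" using awalk_append_cancel[OF pr] qr s by simp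
      ultimately have "pth w s \<in> ?C" by blast
      moreover have "gh u (p @ r) \<otimes> pth u' (q @ r) = pth w s"
        using gh_pth_prefix[OF pr sw] s by simp
      ultimately show ?thesis using eq Cc lspan_base by simp
    next
      case False
      \<comment> \<open>Since \<open>p\<close> is shortest, a prefix in the opposite direction is an
        equality, which the case assumption admits only for \<open>u \<noteq> u'\<close>.\<close>
      have "u \<noteq> u' \<or> (\<not> prefix (p @ r) (q @ r) \<and> \<not> prefix (q @ r) (p @ r))"
      proof (cases "prefix (q @ r) (p @ r)")
        case True
        then obtain s where "p @ r = (q @ r) @ s" by (rule prefixE)
        moreover from this have "length (p @ r) = length ((q @ r) @ s)" by (rule arg_cong)
        then have "s = []" using q(3) by simp
        ultimately show ?thesis using False by simp
      qed (use False in blast)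
      then show ?thesis unfolding eq using gh_pth_orth[OF pr qr] by (simp add: lspan.zero)
    qed
  qed
  have x'c: "x' \<in> carrier R" using x' Hc by (rule lspan_closed)
  have "gh u (p @ r) \<otimes> x \<otimes> pth v r = k \<odot> (gh u (p @ r) \<otimes> (pth u p \<otimes> pth v r))
    \<oplus> gh u (p @ r) \<otimes> x' \<otimes> pth v r"
    using pth_closed[OF aw] gh_closed[OF pr] pth_closed[OF r] x'c
    by (simp add: p(3) r_distr l_distr m_closed smult_closed m_assoc flip: smult_mult_l smult_mult_r)
  also have "gh u (p @ r) \<otimes> (pth u p \<otimes> pth v r) = P w"
    using gh_pth[OF pr] by (simp add: pth_append[OF aw r])
  finally have eq: "gh u (p @ r) \<otimes> x \<otimes> pth v r = k \<odot> P w \<oplus> gh u (p @ r) \<otimes> x' \<otimes> pth v r" .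
  obtain a b where ab: "a \<in> carrier R" "b \<in> carrier R"
    "a \<otimes> (k \<odot> P w \<oplus> gh u (p @ r) \<otimes> x' \<otimes> pth v r) \<otimes> b = P w"
    using vertex_from_unipotent[OF t p(2)] by blast
  have xc: "x \<in> carrier R" using H(3) Hc G by (auto intro!: lspan_closed[OF H(3)] closed)
  have "(a \<otimes> gh u (p @ r)) \<otimes> x \<otimes> pth v r \<otimes> b = P w"
    using ab(3)[folded eq] ab(1,2) xc gh_closed[OF pr] pth_closed[OF r] by (simp add: m_assoc m_closed)
  moreover have "a \<otimes> gh u (p @ r) \<in> carrier R" using ab(1) gh_closed[OF pr] by (rule m_closed)
  ultimately show ?thesis using ab(2) by blast
qed

section \<open>Removing ghost arcs by induction on the length of the ghost part\<close>

definition bounded_monomials :: "nat \<Rightarrow> 'a set" where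
  "bounded_monomials n = {pth u p \<otimes> gh u' q | u p u' q z. awalk u p z \<and> awalk u' q z \<and> length q \<le> n}"

lemma bounded_monomialsI:
  "\<lbrakk>awalk u p z; awalk u' q z; length q \<le> n\<rbrakk> \<Longrightarrow> pth u p \<otimes> gh u' q \<in> bounded_monomials n"
  unfolding bounded_monomials_def by blast

lemma bounded_monomials_mono:
  assumes "m \<le> n"
  shows "bounded_monomials m \<subseteq> bounded_monomials n"
proof
  fix g assume "g \<in> bounded_monomials m"
  then obtain u p u' q z where "g = pth u p \<otimes> gh u' q" "awalk u p z" "awalk u' q z" "length q \<le> m"
    by (auto simp: bounded_monomials_def)
  then show "g \<in> bounded_monomials n" using assms by (simp add: bounded_monomialsI)
qed

lemma bounded_monomials_closed: "bounded_monomials n \<subseteq> carrier R"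
  by (auto simp: bounded_monomials_def intro!: closed)

text \<open>\<open>X e\<close> cancels the rightmost ghost arc or gives zero; if the ghost part is
  empty, \<open>X e\<close> lengthens the path instead and the ghost part stays empty.\<close>

lemma bounded_monomials_mult_X:
  assumes x: "x \<in> lspan R (bounded_monomials (Suc n))" and e: "e \<in> arcs E"
  shows "x \<otimes> X e \<in> lspan R (bounded_monomials n)"
  using x bounded_monomials_closed bounded_monomials_closed generators_closed(2)[OF e]
proof (rule lspan_r_image)
  fix g assume "g \<in> bounded_monomials (Suc n)"
  then obtain u p u' q z where g: "g = pth u p \<otimes> gh u' q" "awalk u p z" "awalk u' q z"
    "length q \<le> Suc n"
    by (auto simp: bounded_monomials_def)
  have gX: "g \<otimes> X e = pth u p \<otimes> (gh u' q \<otimes> X e)"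
    using g e by (simp add: m_assoc closed)
  have "g \<otimes> X e = \<zero> \<or> g \<otimes> X e \<in> bounded_monomials n"
  proof (cases q)
    case Nil
    then have z: "u' = z" "z \<in> verts E" using g(3) by (auto simp: awalk_simps)
    have e1: "awalk (tail E e) [e] (head E e)" using e by (rule arc_implies_awalk)
    have Xe: "pth (tail E e) [e] = X e" using e by (simp add: X_P)
    show ?thesis
    proof (cases "z = tail E e")
      case True
      have pe: "awalk u (p @ [e]) (head E e)"
        using g(2) e1 True by (simp add: awalk_appendI del: awalk_append_iff)
      have "g \<otimes> X e = pth u (p @ [e])"
        using gX g(2) True z Nil e1 e pth_append[of u p z "[e]"] Xe by (simp add: P_X)
      also have "\<dots> = pth u (p @ [e]) \<otimes> gh (head E e) []" using pth_P[OF pe] by simp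
      finally have "g \<otimes> X e = pth u (p @ [e]) \<otimes> gh (head E e) []" .
      moreover have "awalk (head E e) [] (head E e)" using e by (simp add: awalk_simps)
      ultimately show ?thesis unfolding bounded_monomials_def using pe
        by (metis (mono_tags, lifting) le0 list.size(3) mem_Collect_eq)
    next
      case False
      then have "P z \<otimes> X e = \<zero>" using P_pth_orth[OF e1 z(2)] Xe by simp
      then show ?thesis using gX Nil z g(2) by (simp add: r_null closed)
    qed
  next
    case (Cons f r)
    then have f: "f \<in> arcs E" "awalk (head E f) r z" using g(3) by (auto simp: awalk_simps)
    have gX: "g \<otimes> X e = pth u p \<otimes> (gh (head E f) r \<otimes> (Y f \<otimes> X e))"
      using gX Cons f e by (simp add: m_assoc closed)
    show ?thesis
    proof (cases "e = f")
      case True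
      then have "g \<otimes> X e = pth u p \<otimes> gh (head E f) r" using gX f by (simp add: Y_X gh_P)
      then show ?thesis using g f Cons unfolding bounded_monomials_def by auto
    next
      case False
      then show ?thesis using gX f e g(2) by (simp add: Y_X_orth r_null closed)
    qed
  qed
  then show "g \<otimes> X e \<in> lspan R (bounded_monomials n)"
    using lspan.zero lspan_base[OF _ bounded_monomials_closed] by metis
qed

lemma vertex_from_element_no_ghost:
  assumes x: "x \<in> lspan R (bounded_monomials 0)" "x \<noteq> \<zero>"
  shows "\<exists>a\<in>carrier R. \<exists>b\<in>carrier R. a \<otimes> x \<otimes> b = P w"
proof -
  have xc: "x \<in> carrier R" using x bounded_monomials_closed lspan_closed by blast
  obtain v where v: "v \<in> verts E" "x \<otimes> P v \<noteq> \<zero>" using eq_zero_if_mult_P[OF xc] x by blast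
  have "x \<otimes> P v \<in> lspan R {pth u p | u p. awalk u p v}"
    using x(1) bounded_monomials_closed _ generators_closed(1)[OF v(1)]
  proof (rule lspan_r_image)
    fix g assume "g \<in> bounded_monomials 0"
    then obtain u p z where g: "g = pth u p \<otimes> P z" "awalk u p z"
      by (auto simp: bounded_monomials_def awalk_simps)
    then have g': "g = pth u p" by (simp add: pth_P)
    show "g \<otimes> P v \<in> lspan R {pth u p | u p. awalk u p v}"
    proof (cases "z = v")
      case True
      then have "g \<otimes> P v = pth u p" using g' g by (simp add: pth_P)
      then show ?thesis using g True by (intro lspan_base) (auto intro: closed)
    next
      case False
      then have "g \<otimes> P v = \<zero>" using g' g pth_P_orth[OF g(2) v(1)] by simp
      then show ?thesis by (simp add: lspan.zero)
    qed
  qed (auto intro: closed)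
  moreover obtain r where r: "awalk v r w" using reach v(1) by blast
  ultimately obtain a b where ab: "a \<in> carrier R" "b \<in> carrier R"
      "a \<otimes> (x \<otimes> P v) \<otimes> pth v r \<otimes> b = P w"
    using vertex_from_path_combination v(2) by blast
  then have "a \<otimes> x \<otimes> (P v \<otimes> pth v r \<otimes> b) = P w"
    using xc v(1) r by (simp add: m_assoc closed)
  moreover have "P v \<otimes> pth v r \<otimes> b \<in> carrier R" using ab v(1) r by (simp add: closed)
  ultimately show ?thesis using ab(1) by blast
qed

text \<open>If some \<open>x X e\<close> is nonzero, the induction applies to it. Otherwise
  \<open>x P v = y + s\<close> is examined at one vertex \<open>v\<close>, where \<open>y\<close>
  has no ghost arcs and each term of \<open>s\<close> ends in one. A sink has \<open>s = 0\<close>,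
  a finite emitter is impossible, and an infinite emitter has an arc that separates \<open>y\<close>
  from \<open>s\<close>.\<close>

lemma vertex_from_bounded_element:
  "x \<in> lspan R (bounded_monomials n) \<Longrightarrow> x \<noteq> \<zero> \<Longrightarrow>
    \<exists>a\<in>carrier R. \<exists>b\<in>carrier R. a \<otimes> x \<otimes> b = P w"
proof (induction n arbitrary: x)
  case 0
  then show ?case by (rule vertex_from_element_no_ghost)
next
  case (Suc n)
  have xc: "x \<in> carrier R" using Suc.prems bounded_monomials_closed lspan_closed by blast
  show ?case
  proof (cases "\<exists>e\<in>arcs E. x \<otimes> X e \<noteq> \<zero>")
    case True
    then obtain e where e: "e \<in> arcs E" "x \<otimes> X e \<noteq> \<zero>" by blast
    then obtain a b where "a \<in> carrier R" "b \<in> carrier R" "a \<otimes> (x \<otimes> X e) \<otimes> b = P w"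
      using Suc.IH bounded_monomials_mult_X[OF Suc.prems(1)] by blast
    then have "a \<in> carrier R" "X e \<otimes> b \<in> carrier R" "a \<otimes> x \<otimes> (X e \<otimes> b) = P w"
      using e xc by (simp_all add: m_assoc closed)
    then show ?thesis by blast
  next
    case False
    obtain v where v: "v \<in> verts E" "x \<otimes> P v \<noteq> \<zero>"
      using eq_zero_if_mult_P[OF xc] Suc.prems by blast
    have null: "x \<otimes> P v \<otimes> X e = \<zero>" if "e \<in> out_arcs E v" for e
    proof -
      have "x \<otimes> P v \<otimes> X e = x \<otimes> X e" using that xc v(1) P_X[of e] by (auto simp: m_assoc closed)
      then show ?thesis using False that by auto
    qed
    let ?B = "{z \<otimes> Y e | z e. z \<in> carrier R \<and> e \<in> out_arcs E v}"
    obtain y s where ys: "y \<in> lspan R {pth u p | u p. awalk u p v}" "s \<in> lspan R ?B"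
      "x \<otimes> P v = y \<oplus> s"
      using mult_P_decomp[OF xc v(1)] by blast
    have Bc: "?B \<subseteq> carrier R" by (auto intro: closed)
    have sc: "s \<in> carrier R" using ys(2) Bc by (rule lspan_closed)
    have yc: "y \<in> carrier R" using ys(1) by (rule lspan_closed) (auto intro: closed)
    have XY: "X e \<otimes> Y e \<in> carrier R" if "e \<in> out_arcs E v" for e
      using that by (auto intro: closed)
    have null': "x \<otimes> P v \<otimes> (X e \<otimes> Y e) = \<zero>" if "e \<in> out_arcs E v" for e
      using null[OF that] that xc v(1) by (auto simp: closed l_null simp flip: m_assoc)
    \<comment> \<open>If \<open>y = 0\<close>, then \<open>s = x P v\<close> is fixed on the right
      by a finite sum of elements \<open>X e Y e\<close>, each of which annihilates it.\<close>
    have "y \<noteq> \<zero>"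
    proof
      assume "y = \<zero>"
      then have s: "x \<otimes> P v = s" using ys sc by simp
      have "s = \<zero>"
        using ys(2) Bc
      proof (rule lspan_orthogonal_eq_zero[where \<epsilon> = "\<lambda>e. X e \<otimes> Y e" and I = "out_arcs E v"])
        fix e f assume ef: "e \<in> out_arcs E v" "f \<in> out_arcs E v"
        then have "X e \<otimes> Y e \<otimes> (X f \<otimes> Y f) = X e \<otimes> ((Y e \<otimes> X f) \<otimes> Y f)"
          by (simp add: m_assoc closed)
        then show "X e \<otimes> Y e \<otimes> (X f \<otimes> Y f) = (if e = f then X e \<otimes> Y e else \<zero>)"
          using ef by (simp add: Y_X Y_X_orth P_Y l_null r_null closed)
      next
        fix g assume "g \<in> ?B"
        then obtain z e where g: "g = z \<otimes> Y e" "z \<in> carrier R" "e \<in> out_arcs E v" by blast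
        then have "g \<otimes> (X e \<otimes> Y e) = z \<otimes> ((Y e \<otimes> X e) \<otimes> Y e)"
          by (simp add: m_assoc closed)
        then have "g \<otimes> (X e \<otimes> Y e) = g" using g by (simp add: Y_X P_Y)
        then show "\<exists>e\<in>out_arcs E v. g \<otimes> (X e \<otimes> Y e) = g" using g(3) by blast
      qed (use XY null' s in auto)
      then show False using s v(2) by simp
    qed
    show ?thesis
    proof (cases "out_arcs E v = {}")
      case True
      then have "?B \<subseteq> {\<zero>}" by blast
      with ys(2) have "s = \<zero>" by (rule lspan_eq_zero)
      then have xy: "x \<otimes> P v = y" using ys yc by simp
      obtain r where r: "awalk v r w" using reach v(1) by blast
      obtain a b where ab: "a \<in> carrier R" "b \<in> carrier R"
        "a \<otimes> (x \<otimes> P v) \<otimes> pth v r \<otimes> b = P w"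
        using vertex_from_path_combination[OF ys(1) \<open>y \<noteq> \<zero>\<close> r] xy by blast
      then have "a \<otimes> x \<otimes> (P v \<otimes> pth v r \<otimes> b) = P w"
        using xc v(1) r by (simp add: m_assoc closed)
      moreover have "P v \<otimes> pth v r \<otimes> b \<in> carrier R" using ab v(1) r by (simp add: closed)
      ultimately show ?thesis using ab(1) by blast
    next
      case nonempty: False
      \<comment> \<open>At a finite emitter the elements \<open>X e Y e\<close>, all of which
        annihilate \<open>x P v\<close>, add up to \<open>P v\<close>.\<close>
      have "infinite (out_arcs E v)"
      proof
        assume fin: "finite (out_arcs E v)"
        then have "finite_emitter E v" using nonempty v(1) by (simp add: finite_emitter_def)
        then have "x \<otimes> P v = x \<otimes> P v \<otimes> (\<Oplus>e\<in>out_arcs E v. X e \<otimes> Y e)"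
          using P_emitter[of v] P_P[OF v(1)] xc v(1) by (simp add: m_assoc closed)
        also have "\<dots> = (\<Oplus>e\<in>out_arcs E v. x \<otimes> P v \<otimes> (X e \<otimes> Y e))"
          using fin xc v(1) XY by (intro finsum_rdistr) (auto intro: closed)
        also have "\<dots> = (\<Oplus>e\<in>out_arcs E v. \<zero>)"
          using null' by (intro finsum_cong') auto
        finally show False using v(2) by simp
      qed
      moreover obtain F where F: "finite F" "\<And>f. f \<in> out_arcs E v - F \<Longrightarrow> s \<otimes> X f = \<zero>"
        using lspan_arc_avoid[OF ys(2)] by blast
      ultimately obtain f where f: "f \<in> out_arcs E v" "f \<notin> F"
        by (meson finite_subset subsetI)
      then have fa: "f \<in> arcs E" "tail E f = v" by auto
      have "(y \<oplus> s) \<otimes> X f = \<zero>" using null[OF f(1)] ys(3) by simp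
      then have yf: "y \<otimes> X f = \<zero>" using F(2) f fa yc sc by (simp add: l_distr closed)
      obtain r where r: "awalk (head E f) r w"
        using reach[OF head_in_verts[OF fa(1)]] by blast
      then have fr: "awalk v (f # r) w" using fa by (simp add: awalk_simps)
      \<comment> \<open>Extraction along a walk that begins with \<open>f\<close> would produce
        \<open>P w\<close> out of \<open>y X f = 0\<close>.\<close>
      obtain a b where ab: "a \<in> carrier R" "b \<in> carrier R" "a \<otimes> y \<otimes> pth v (f # r) \<otimes> b = P w"
        using vertex_from_path_combination[OF ys(1) \<open>y \<noteq> \<zero>\<close> fr] by blast
      have "P w = a \<otimes> ((y \<otimes> X f) \<otimes> (pth (head E f) r \<otimes> b))"
        using ab yc fa r by (simp add: m_assoc closed)
      then have "P w = \<zero>" using yf ab r by (simp add: l_null r_null closed)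
      then show ?thesis using P_nonzero w by blast
    qed
  qed
qed

lemma vertex_from_element:
  assumes x: "x \<in> carrier R" "x \<noteq> \<zero>"
  obtains a b where "a \<in> carrier R" "b \<in> carrier R" "a \<otimes> x \<otimes> b = P w"
proof -
  have "\<exists>n. x \<in> lspan R (bounded_monomials n)"
    using x(1) unfolding carrier_eq_lspan
  proof induction
    case zero
    then show ?case by (simp add: lspan.zero)
  next
    case (step g x k)
    then obtain n where n: "x \<in> lspan R (bounded_monomials n)" by blast
    obtain u p u' q z where g: "g = pth u p \<otimes> gh u' q" "awalk u p z" "awalk u' q z"
      using step.hyps(1) by (auto simp: monomials_def)
    let ?n = "max n (length q)"
    have "bounded_monomials n \<subseteq> bounded_monomials ?n" by (simp add: bounded_monomials_mono)
    from lspan_mono[OF this] n have "x \<in> lspan R (bounded_monomials ?n)" by (rule subsetD)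
    moreover have "g \<in> bounded_monomials ?n"
      using g by (simp add: bounded_monomialsI)
    ultimately have "k \<odot> g \<oplus> x \<in> lspan R (bounded_monomials ?n)" by (intro lspan.step)
    then show ?case by blast
  qed
  then obtain n where "x \<in> lspan R (bounded_monomials n)" by blast
  from vertex_from_bounded_element[OF this x(2)] show ?thesis using that by blast
qed

section \<open>Pure infiniteness and simplicity\<close>

lemma c_d_orth: "gh w c \<otimes> pth w d = \<zero>"
  using gh_pth_orth[OF c(1) d] cd by blast

lemma purely_infinite: "purely_infinite R"
  unfolding purely_infinite_def
proof (intro allI impI, elim conjE)
  fix I assume I: "right_ideal R I" "I \<noteq> {\<zero>}"
  note Ic = right_idealD[OF I(1)]
  obtain x where x: "x \<in> I" "x \<noteq> \<zero>" using I(2) Ic(2) by blast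
  have xc: "x \<in> carrier R" using x Ic(1) by blast
  obtain a' b' where ab': "a' \<in> carrier R" "b' \<in> carrier R" "a' \<otimes> x \<otimes> b' = P w"
    using vertex_from_element xc x(2) by blast
  define a b where "a = P w \<otimes> a'" and "b = b' \<otimes> P w"
  have ab: "a \<in> carrier R" "b \<in> carrier R" using ab' w by (simp_all add: a_def b_def closed)
  have wa: "P w \<otimes> a = a" and bw: "b \<otimes> P w = b"
    using ab' w P_P[OF w] by (simp_all add: a_def b_def closed m_assoc) (simp add: closed flip: m_assoc)
  have "a \<otimes> x \<otimes> b = P w \<otimes> (a' \<otimes> x \<otimes> b') \<otimes> P w"
    using ab'(1,2) xc w by (simp add: a_def b_def closed m_assoc)
  then have axb: "a \<otimes> x \<otimes> b = P w" using ab'(3) P_P[OF w] by simp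
  have pc: "pth w c \<in> carrier R" "gh w c \<in> carrier R" "P w \<in> carrier R" using c w by (auto intro: closed)
  \<comment> \<open>\<open>T\<close> transports the corner at \<open>P w\<close> into the right
    ideal. The identity \<open>a x b = P w\<close> makes it multiplicative on that corner, and
    injective because \<open>a (T z) x b\<close> recovers \<open>z\<close>.\<close>
  define T where "T z = x \<otimes> b \<otimes> z \<otimes> a" for z
  have Tc: "T z \<in> carrier R" if "z \<in> carrier R" for z
    using that xc ab by (simp add: T_def m_closed)
  have T_mult: "T y \<otimes> T z = T (y \<otimes> P w \<otimes> z)" if "y \<in> carrier R" "z \<in> carrier R" for y z
  proof -
    have "T y \<otimes> T z = x \<otimes> b \<otimes> y \<otimes> (a \<otimes> x \<otimes> b) \<otimes> z \<otimes> a"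
      using that xc ab by (simp add: T_def m_closed m_assoc)
    then show ?thesis using that xc ab pc by (simp add: axb T_def m_closed m_assoc)
  qed
  have aTb: "a \<otimes> x \<otimes> b \<otimes> z \<otimes> (a \<otimes> x \<otimes> b) = a \<otimes> T z \<otimes> (x \<otimes> b)" if "z \<in> carrier R" for z
    using that xc ab by (simp add: T_def m_closed m_assoc)
  have cP: "P w \<otimes> pth w c = pth w c" "pth w c \<otimes> P w = pth w c"
    "P w \<otimes> gh w c = gh w c" "gh w c \<otimes> P w = gh w c"
    using c by (simp_all add: P_pth pth_P P_gh gh_P)
  \<comment> \<open>If \<open>c c^* = w\<close>, then \<open>d = c c^* d = 0\<close> by
    incomparability, and \<open>w = d^* d = 0\<close>.\<close>
  have ne: "pth w c \<otimes> gh w c \<noteq> P w"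
  proof
    assume "pth w c \<otimes> gh w c = P w"
    then have "pth w d = pth w c \<otimes> (gh w c \<otimes> pth w d)"
      using P_pth[OF d] pc d by (simp add: closed flip: m_assoc)
    then have "pth w d = \<zero>" using c_d_orth pc by (simp add: r_null)
    then have "P w = \<zero>" using gh_pth[OF d] d by (simp add: r_null closed)
    then show False using P_nonzero w by blast
  qed
  have "infinite_idempotent R (T (P w))"
  proof (rule infinite_idempotentI)
    show "T (P w) \<in> carrier R" "T (pth w c) \<in> carrier R" "T (gh w c) \<in> carrier R"
      using pc Tc by auto
    show "T (P w) \<otimes> T (P w) = T (P w)" "T (P w) \<otimes> T (pth w c) = T (pth w c)"
      "T (pth w c) \<otimes> T (P w) = T (pth w c)" "T (P w) \<otimes> T (gh w c) = T (gh w c)"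
      "T (gh w c) \<otimes> T (P w) = T (gh w c)" "T (gh w c) \<otimes> T (pth w c) = T (P w)"
      using pc w by (simp_all add: T_mult P_P cP gh_pth[OF c(1)])
    show "T (pth w c) \<otimes> T (gh w c) \<noteq> T (P w)"
    proof
      assume "T (pth w c) \<otimes> T (gh w c) = T (P w)"
      then have "T (pth w c \<otimes> gh w c) = T (P w)" using pc by (simp add: T_mult cP)
      then have "P w \<otimes> (pth w c \<otimes> gh w c) \<otimes> P w = P w \<otimes> P w \<otimes> P w"
        using aTb[of "pth w c \<otimes> gh w c"] aTb[of "P w"] pc by (simp add: axb m_closed)
      then have "pth w c \<otimes> gh w c = P w" using pc cP P_P[OF w] by (simp add: m_assoc m_closed)
          (simp add: m_closed cP flip: m_assoc)
      then show False using ne by contradiction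
    qed
  qed
  moreover have "T (P w) \<in> I"
    unfolding T_def using x xc ab pc Ic(6) by simp
  ultimately show "\<exists>a\<in>I. infinite_idempotent R a" by blast
qed

text \<open>The vertices in a nonzero ideal form a hereditary set because
  \<open>Y e P (tail E e) X e = P (head E e)\<close>, and a saturated one by the emitter relation.
  Once all vertices lie in the ideal, so do all monomials, as each absorbs its starting
  vertex.\<close>

lemma simple_ring:
  assumes hs: "\<And>S. S \<subseteq> verts E \<Longrightarrow> hereditary E S \<Longrightarrow> saturated E S \<Longrightarrow> S = {} \<or> S = verts E"
  shows "simple_ring R"
  unfolding simple_ring_def
proof (intro conjI allI impI)
  show "\<exists>x\<in>carrier R. \<exists>y\<in>carrier R. x \<otimes> y \<noteq> \<zero>"
    using w P_P[OF w] P_nonzero[OF w] generators_closed(1)[OF w] by metis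
next
  fix I assume I: "two_sided_ideal R I"
  then have rI: "right_ideal R I" and lI: "\<And>a x. a \<in> I \<Longrightarrow> x \<in> carrier R \<Longrightarrow> x \<otimes> a \<in> I"
    by (auto simp: two_sided_ideal_def)
  note Ic = right_idealD[OF rI]
  show "I = {\<zero>} \<or> I = carrier R"
  proof (rule disjCI)
    assume "I \<noteq> carrier R"
    show "I = {\<zero>}"
    proof (rule ccontr)
      assume "I \<noteq> {\<zero>}"
      then obtain x where x: "x \<in> I" "x \<noteq> \<zero>" using Ic(2) by blast
      then obtain a b where ab: "a \<in> carrier R" "b \<in> carrier R" "a \<otimes> x \<otimes> b = P w"
        using vertex_from_element Ic(1) by blast
      then have wI: "P w \<in> I" using Ic(6)[OF lI[OF x(1) ab(1)] ab(2)] by simp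
      define S where "S = {v \<in> verts E. P v \<in> I}"
      have arc: "X e \<otimes> P (head E e) \<otimes> Y e = X e \<otimes> Y e" if "e \<in> arcs E" for e
        using that X_P by simp
      have "hereditary E S"
        unfolding hereditary_def
      proof (intro ballI impI)
        fix e assume e: "e \<in> arcs E" "tail E e \<in> S"
        then have "Y e \<otimes> P (tail E e) \<otimes> X e \<in> I"
          using Ic(6) lI by (auto simp: S_def closed)
        then show "head E e \<in> S" using e by (simp add: S_def Y_P Y_X)
      qed
      moreover have "saturated E S"
        unfolding saturated_def
      proof (intro allI impI)
        fix v assume v: "finite_emitter E v" "head E ` out_arcs E v \<subseteq> S"
        have XY: "X e \<otimes> Y e \<in> I" if "e \<in> out_arcs E v" for e
        proof -
          have "head E e \<in> S" using that v(2) by blast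
          then have e: "e \<in> arcs E" "P (head E e) \<in> I" using that by (auto simp: S_def)
          then have "X e \<otimes> P (head E e) \<otimes> Y e \<in> I" by (intro Ic(6) lI closed)
          then show ?thesis using arc e by simp
        qed
        have "(\<Oplus>e\<in>F. X e \<otimes> Y e) \<in> I" if "finite F" "F \<subseteq> out_arcs E v" for F
          using that
        proof (induction F rule: finite_induct)
          case (insert e F)
          then have e: "X f \<otimes> Y f \<in> I" if "f \<in> insert e F" for f
            using XY that by blast
          then have "(\<lambda>e. X e \<otimes> Y e) \<in> F \<rightarrow> carrier R" "X e \<otimes> Y e \<in> carrier R"
            using Ic(1) by auto
          then show ?case using insert e Ic(3) by simp
        qed (use Ic(2) in simp)
        then have "P v \<in> I" using v(1) P_emitter[OF v(1)] by (simp add: finite_emitter_def)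
        then show "v \<in> S" using v(1) by (simp add: S_def finite_emitter_def)
      qed
      ultimately have "S = verts E" using hs[of S] wI w by (auto simp: S_def)
      have "z \<in> I" if "z \<in> carrier R" for z
        using that unfolding carrier_eq_lspan
      proof induction
        case zero
        then show ?case using Ic(2) by simp
      next
        case (step g z k)
        obtain u p u' q y where g: "g = pth u p \<otimes> gh u' q" "awalk u p y" "awalk u' q y" "u \<in> verts E"
          using step.hyps(1) by (auto simp: monomials_def)
        then have gc: "g \<in> carrier R" by (simp add: closed)
        have "u \<in> S" using \<open>S = verts E\<close> g(4) by simp
        then have "P u \<otimes> (k \<odot> g) \<in> I" using gc Ic(6) by (simp add: S_def smult_closed)
        moreover have "P u \<otimes> (k \<odot> g) = k \<odot> g"
          using g gc by (simp add: closed P_pth flip: smult_mult_r m_assoc)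
        ultimately show ?case using step.IH Ic(3) by simp
      qed
      then show False using \<open>I \<noteq> carrier R\<close> Ic(1) by blast
    qed
  qed
qed

end

section \<open>Acyclic graphs\<close>

context leavitt_algebra
begin

text \<open>Between two occurrences of the same arc lies a closed path. Hence walks repeat no arc,
  and those with arcs in \<open>F\<close> have length at most \<open>card F\<close>.\<close>

lemma acyclic_finite_monomials:
  assumes acyclic: "\<nexists>p. closed_w p" and "finite W" "finite F"
  shows "finite (monomials W F)"
proof -
  have dist: "distinct p" if p: "awalk u p v" for u p v
  proof (rule ccontr)
    assume "\<not> distinct p"
    then obtain xs ys zs e where "p = xs @ [e] @ ys @ [e] @ zs"
      using not_distinct_decomp by blast
    then have "awalk (tail E e) (e # ys) (tail E e)"
      using p by (auto simp: awalk_simps)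
    then show False using acyclic unfolding closed_w_def by blast
  qed
  let ?Q = "{p. set p \<subseteq> F \<and> length p \<le> card F}"
  have fin: "finite ?Q" using \<open>finite F\<close> by (rule finite_lists_length_le)
  have Q: "p \<in> ?Q" if "awalk u p v" "set p \<subseteq> F" for u p v
    using dist[OF that(1)] that(2) \<open>finite F\<close> by (simp add: card_mono flip: distinct_card)
  have "monomials W F \<subseteq> (\<lambda>(u, p, u', q). pth u p \<otimes> gh u' q) ` (W \<times> ?Q \<times> W \<times> ?Q)"
  proof
    fix g assume "g \<in> monomials W F"
    then obtain u p u' q z where g: "g = pth u p \<otimes> gh u' q" "awalk u p z" "awalk u' q z"
      "set p \<subseteq> F" "set q \<subseteq> F" "u \<in> W" "u' \<in> W"
      by (auto simp: monomials_def)
    then show "g \<in> (\<lambda>(u, p, u', q). pth u p \<otimes> gh u' q) ` (W \<times> ?Q \<times> W \<times> ?Q)"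
      using Q[OF g(2,4)] Q[OF g(3,5)] by (intro image_eqI[of _ _ "(u, p, u', q)"]) auto
  qed
  then show ?thesis by (rule finite_subset) (use fin \<open>finite W\<close> in simp)
qed

text \<open>In the acyclic case the powers of \<open>x\<close> lie in a finite-dimensional space, and a left inverse
  \<open>y\<close> of \<open>x\<close> turns a linear dependence between them into \<open>a \<in> x R\<close>.\<close>

lemma acyclic_no_infinite_idempotent:
  assumes acyclic: "\<nexists>p. closed_w p"
  shows "\<not> infinite_idempotent R a"
proof
  assume "infinite_idempotent R a"
  then obtain x y where xy: "a \<in> carrier R" "x \<in> carrier R" "y \<in> carrier R" "a \<otimes> x = x" "x \<otimes> a = x"
    "y \<otimes> x = a" "a \<notin> principal_right R x"
    by (rule infinite_idempotentE)
  obtain W F where WF: "finite W" "finite F" "W \<subseteq> verts E" "F \<subseteq> arcs E"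
    "x \<in> lspan R (monomials W F)"
    using in_finite_lspan[OF xy(2)] .
  \<comment> \<open>Without a unit there is no zeroth power: \<open>w i\<close> is the power of
    \<open>x\<close> with exponent \<open>i + 1\<close>.\<close>
  define w where "w i = (((\<otimes>) x) ^^ i) x" for i
  have w0: "w 0 = x" and wS: "w (Suc i) = x \<otimes> w i" for i by (simp_all add: w_def)
  have wc: "w i \<in> carrier R" for i by (induction i) (use xy in \<open>simp_all add: w0 wS m_closed\<close>)
  have aw: "a \<otimes> w i = w i" for i
    by (cases i) (use xy wc in \<open>simp_all add: w0 wS flip: m_assoc\<close>)
  have "w i \<in> lspan R (monomials W F)" for i
    by (induction i) (use WF in \<open>simp_all add: w0 wS lspan_monomials_mult\<close>)
  then obtain m where m: "w m \<in> lspan R (w ` {m<..})"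
    using sequence_in_finite_lspan[OF acyclic_finite_monomials[OF acyclic WF(1,2)] monomials_closed, of w]
    by blast
  \<comment> \<open>The witness is the power of \<open>y\<close> with exponent \<open>m + 1\<close>;
    it turns \<open>w m\<close> into \<open>a\<close> and leaves a positive power of
    \<open>x\<close> from each later term.\<close>
  have "\<exists>z\<in>carrier R. z \<otimes> w m = a \<and> (\<forall>i>m. z \<otimes> w i = w (i - Suc m))"
  proof (induction m)
    case 0
    have "y \<otimes> w i = w (i - Suc 0)" if "i > 0" for i
      using that xy wc aw by (cases i) (simp_all add: wS flip: m_assoc)
    then show ?case using xy w0 by blast
  next
    case (Suc m)
    then obtain z where z: "z \<in> carrier R" "z \<otimes> w m = a" "\<And>i. i > m \<Longrightarrow> z \<otimes> w i = w (i - Suc m)"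
      by blast
    have "y \<otimes> z \<otimes> w (Suc m) = a" using z(1) z(3)[of "Suc m"] xy wc by (simp add: m_assoc w0)
    moreover have "y \<otimes> z \<otimes> w i = w (i - Suc (Suc m))" if "i > Suc m" for i
    proof -
      have "i - Suc m = Suc (i - Suc (Suc m))" using that by simp
      then have "y \<otimes> z \<otimes> w i = y \<otimes> (x \<otimes> w (i - Suc (Suc m)))"
        using z(1) z(3)[of i] that xy wc by (simp add: m_assoc wS)
      then show ?thesis using xy wc aw by (simp flip: m_assoc)
    qed
    ultimately show ?case using z(1) xy(3) by (intro bexI[of _ "y \<otimes> z"]) (simp_all add: m_closed)
  qed
  then obtain z where z: "z \<in> carrier R" "z \<otimes> w m = a" "\<And>i. i > m \<Longrightarrow> z \<otimes> w i = w (i - Suc m)"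
    by blast
  have rw: "range w \<subseteq> carrier R" and mw: "w ` {m<..} \<subseteq> carrier R" using wc by auto
  have "z \<otimes> w m \<in> lspan R (range w)"
    using m mw rw z(1)
  proof (rule lspan_l_image)
    fix g assume "g \<in> w ` {m<..}"
    then obtain i where "i > m" "g = w i" by auto
    then have "z \<otimes> g = w (i - Suc m)" using z(3) by simp
    then show "z \<otimes> g \<in> lspan R (range w)" using rw by (simp add: lspan_base)
  qed
  then have "a \<in> lspan R (range w)" by (simp add: z(2))
  then have "\<exists>r\<in>carrier R. a = x \<otimes> r"
  proof induction
    case zero
    show ?case using xy(2) by (intro bexI[of _ \<zero>]) (simp_all add: r_null)
  next
    case (step g s c)
    then obtain i r where ir: "g = w i" "r \<in> carrier R" "s = x \<otimes> r" by blast
    \<comment> \<open>For \<open>w 0 = x\<close> the witness is \<open>a\<close>, since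
      \<open>x a = x\<close>.\<close>
    obtain t where t: "t \<in> carrier R" "g = x \<otimes> t"
      using ir(1) xy(1,5) wc by (cases i) (metis w0, metis wS)
    then show ?case using ir xy(2)
      by (intro bexI[of _ "c \<odot> t \<oplus> r"]) (simp_all add: r_distr smult_closed flip: smult_mult_r)
  qed
  then show False using xy(7) by (auto simp: principal_right_def)
qed

end

section \<open>Representations on functions\<close>

text \<open>A branching system represents the algebra on the functions on
  \<open>(verts E - H) \<times> nat\<close>: the arc \<open>e\<close> acts through the injection \<open>\<phi> e\<close> of the fibre over its head into
  the fibre over its tail.\<close>

locale branching = wf_digraph E for E :: "('v,'e) pre_digraph" +
  fixes H :: "'v set" and \<phi> :: "'e \<Rightarrow> nat \<Rightarrow> nat"
  assumes hereditary: "hereditary E H"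
    and inj: "e \<in> arcs E \<Longrightarrow> head E e \<notin> H \<Longrightarrow> inj (\<phi> e)"
    and disjoint: "\<lbrakk>e \<in> arcs E; f \<in> arcs E; e \<noteq> f; tail E e = tail E f; head E e \<notin> H; head E f \<notin> H\<rbrakk>
      \<Longrightarrow> range (\<phi> e) \<inter> range (\<phi> f) = {}"
    and cover: "finite_emitter E v \<Longrightarrow> v \<notin> H \<Longrightarrow> \<exists>e\<in>out_arcs E v. head E e \<notin> H \<and> n \<in> range (\<phi> e)"
begin

text \<open>The action is defined on terms and shown afterwards to respect the relations. Arcs push
  functions along \<open>\<phi> e\<close> and ghosts pull them back; an arc ending in
  \<open>H\<close> acts as zero even if it starts outside.\<close>

primrec act :: "('k::field,'v,'e) leavitt_term \<Rightarrow> ('v \<Rightarrow> nat \<Rightarrow> 'k) \<Rightarrow> 'v \<Rightarrow> nat \<Rightarrow> 'k" where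
  "act (Vertex v) f = (\<lambda>u n. if u = v \<and> v \<in> verts E \<and> v \<notin> H then f u n else 0)"
| "act (Edge e) f = (\<lambda>u n. if e \<in> arcs E \<and> head E e \<notin> H \<and> u = tail E e \<and> n \<in> range (\<phi> e)
     then f (head E e) (inv_into UNIV (\<phi> e) n) else 0)"
| "act (Ghost e) f = (\<lambda>u n. if e \<in> arcs E \<and> head E e \<notin> H \<and> u = head E e
     then f (tail E e) (\<phi> e n) else 0)"
| "act Zero f = (\<lambda>u n. 0)"
| "act (Neg s) f = (\<lambda>u n. - act s f u n)"
| "act (Add s t) f = (\<lambda>u n. act s f u n + act t f u n)"
| "act (Mult s t) f = act s (act t f)"
| "act (Scale c s) f = (\<lambda>u n. c * act s f u n)"

lemma act_add: "act t (\<lambda>u n. f u n + g u n) = (\<lambda>u n. act t f u n + act t g u n)"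
  by (induction t arbitrary: f g) (auto simp: algebra_simps intro!: ext)

lemma act_scale: "act t (\<lambda>u n. c * f u n) = (\<lambda>u n. c * act t f u n)"
  by (induction t arbitrary: f) (auto simp: algebra_simps intro!: ext)

lemma act_zero: "act t (\<lambda>u n. 0) = (\<lambda>u n. 0)"
  using act_scale[of t 0 "\<lambda>u n. 0"] by simp

lemma act_edge_ghost:
  "act (Edge e) (act (Ghost e) f) u n =
    (if e \<in> arcs E \<and> head E e \<notin> H \<and> u = tail E e \<and> n \<in> range (\<phi> e) then f u n else 0)"
  by (auto simp: f_inv_into_f)

text \<open>Outside \<open>H\<close> every point of the fibre over \<open>v\<close> lies in the
  range of exactly one arc, so one summand survives. For \<open>v\<close> in \<open>H\<close> all
  heads lie in \<open>H\<close> and both sides vanish.\<close>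

lemma act_emitter:
  assumes v: "finite_emitter E v" and es: "distinct es" "set es = out_arcs E v"
  shows "act (foldr (\<lambda>e. Add (Mult (Edge e) (Ghost e))) es Zero) f = act (Vertex v) f"
proof (intro ext)
  fix u n
  have "act (foldr (\<lambda>e. Add (Mult (Edge e) (Ghost e))) es Zero) f u n
    = (\<Sum>e\<in>set es. act (Edge e) (act (Ghost e) f) u n)"
    using es(1) by (induction es) (simp_all del: act.simps(2,3))
  also have "\<dots> = (\<Sum>e\<in>out_arcs E v. if head E e \<notin> H \<and> u = v \<and> n \<in> range (\<phi> e) then f u n else 0)"
    unfolding es(2)
  proof (rule sum.cong[OF HOL.refl])
    fix e assume "e \<in> out_arcs E v"
    then have "e \<in> arcs E" "tail E e = v" by auto
    then show "act (Edge e) (act (Ghost e) f) u n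
      = (if head E e \<notin> H \<and> u = v \<and> n \<in> range (\<phi> e) then f u n else 0)"
      unfolding act_edge_ghost by simp
  qed
  also have "\<dots> = act (Vertex v) f u n"
  proof (cases "u = v \<and> v \<notin> H")
    case True
    then obtain e where e: "e \<in> out_arcs E v" "head E e \<notin> H" "n \<in> range (\<phi> e)"
      using cover[OF v] by blast
    have "f' = e" if "f' \<in> out_arcs E v" "head E f' \<notin> H" "n \<in> range (\<phi> f')" for f'
      using disjoint[of e f'] e that by auto
    then have "e' \<in> out_arcs E v \<Longrightarrow> head E e' \<notin> H \<and> u = v \<and> n \<in> range (\<phi> e') \<longleftrightarrow> e' = e" for e'
      using e True by blast
    then have "(\<Sum>e\<in>out_arcs E v. if head E e \<notin> H \<and> u = v \<and> n \<in> range (\<phi> e) then f u n else 0)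
      = (\<Sum>e'\<in>out_arcs E v. if e' = e then f u n else 0)"
      by (intro sum.cong[OF HOL.refl]) (simp only:)
    also have "\<dots> = f u n" using e v by (simp add: finite_emitter_def)
    finally show ?thesis using True v by (simp add: finite_emitter_def)
  next
    case False
    have "\<not> (head E e \<notin> H \<and> u = v \<and> n \<in> range (\<phi> e))" if "e \<in> out_arcs E v" for e
      using False hereditary that by (auto simp: hereditary_def)
    then have "(\<Sum>e\<in>out_arcs E v. if head E e \<notin> H \<and> u = v \<and> n \<in> range (\<phi> e) then f u n else 0)
      = (\<Sum>e\<in>out_arcs E v. 0)"
      by (intro sum.cong[OF HOL.refl]) (simp only: if_False)
    then show ?thesis using False by auto
  qed
  finally show "act (foldr (\<lambda>e. Add (Mult (Edge e) (Ghost e))) es Zero) f u n = act (Vertex v) f u n" .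
qed

lemma act_respects: "leavitt_eq E s t \<Longrightarrow> act s f = act t f"
proof (induction arbitrary: f rule: leavitt_eq.induct)
  case (emitter v es)
  from act_emitter[OF this] show ?case by (rule HOL.sym)
next
  case (ghost_edge_same e)
  then show ?case
    using inj[of e] by (auto simp: fun_eq_iff inv_f_f)
next
  case (ghost_edge_diff e e')
  then show ?case using disjoint[of e e'] by (auto simp: fun_eq_iff)
next
  case (cong_Mult s s' t t')
  then show ?case by simp
next
  case (tail_edge e)
  then show ?case using hereditary by (auto simp: fun_eq_iff hereditary_def)
next
  case (ghost_tail e)
  then show ?case using hereditary by (auto simp: fun_eq_iff hereditary_def)
qed (auto simp: fun_eq_iff act_add act_scale algebra_simps)

text \<open>The classes acting as zero form a two-sided ideal. One nonzero class in it makes the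
  whole action trivial, which is later refuted by a vertex that acts nontrivially.\<close>

lemma act_eq_zero_if_simple:
  fixes s t :: "('k::field,'v,'e) leavitt_term"
  assumes simple: "simple_ring (leavitt_path_algebra TYPE('k) E)"
    and s: "\<And>f. act s f = (\<lambda>u n. 0)" "\<not> leavitt_eq E s Zero"
  shows "act t f = (\<lambda>u n. 0)"
proof -
  let ?L = "leavitt_path_algebra TYPE('k) E"
  interpret L: nonunital_algebra ?L by (rule leavitt_path_algebra_is_algebra)
  define I where "I = leavitt_class E ` {t :: ('k,'v,'e) leavitt_term. \<forall>f. act t f = (\<lambda>u n. 0)}"
  have in_I: "leavitt_class E t \<in> I \<longleftrightarrow> (\<forall>f. act t f = (\<lambda>u n. 0))" for t :: "('k,'v,'e) leavitt_term"
  proof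
    assume "leavitt_class E t \<in> I"
    then obtain t' :: "('k,'v,'e) leavitt_term" where
      "leavitt_class E t = leavitt_class E t'" "\<forall>f. act t' f = (\<lambda>u n. 0)"
      unfolding I_def by blast
    then show "\<forall>f. act t f = (\<lambda>u n. 0)" using act_respects unfolding leavitt_class_eq_iff by metis
  qed (auto simp: I_def)
  have IE: "\<exists>t. x = leavitt_class E t \<and> (\<forall>f. act t f = (\<lambda>u n. 0))" if "x \<in> I" for x
    using that by (auto simp: I_def)
  have neg: "\<ominus>\<^bsub>?L\<^esub> leavitt_class E t = leavitt_class E (Neg t)" for t :: "('k,'v,'e) leavitt_term"
    by (rule L.minus_equality) (auto simp: add_L zero_L carrier_L leavitt_class_eq_iff intro: leavitt_eq.add_neg)
  have "two_sided_ideal ?L I"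
    unfolding two_sided_ideal_def right_ideal_def
  proof (intro conjI ballI)
    show "additive_subgroup I ?L"
    proof (intro additive_subgroup.intro L.add.subgroupI)
      show "I \<subseteq> carrier ?L" by (auto simp: I_def carrier_L)
      show "I \<noteq> {}" using in_I[of Zero] by auto
      show "\<ominus>\<^bsub>?L\<^esub> x \<in> I" if "x \<in> I" for x using IE[OF that] by (auto simp: neg in_I)
      show "x \<oplus>\<^bsub>?L\<^esub> y \<in> I" if "x \<in> I" "y \<in> I" for x y
        using IE[OF that(1)] IE[OF that(2)] by (auto simp: add_L in_I)
    qed
  next
    fix x y assume "x \<in> I" "y \<in> carrier ?L"
    then obtain t and r :: "('k,'v,'e) leavitt_term"
      where "x = leavitt_class E t" "\<forall>f. act t f = (\<lambda>u n. 0)" "y = leavitt_class E r"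
      using IE[OF \<open>x \<in> I\<close>] unfolding carrier_L by blast
    then show "x \<otimes>\<^bsub>?L\<^esub> y \<in> I" "y \<otimes>\<^bsub>?L\<^esub> x \<in> I" by (auto simp: mult_L in_I act_zero)
  qed
  then have "I = {\<zero>\<^bsub>?L\<^esub>} \<or> I = carrier ?L" using simple by (simp add: simple_ring_def)
  moreover have "leavitt_class E s \<in> I" "leavitt_class E s \<noteq> \<zero>\<^bsub>?L\<^esub>"
    using s by (auto simp: in_I zero_L leavitt_class_eq_iff)
  ultimately have "I = carrier ?L" by auto
  then show ?thesis using in_I[of t] by (simp add: carrier_L)
qed

primrec ghost_path_term :: "'v \<Rightarrow> 'e list \<Rightarrow> ('k::field,'v,'e) leavitt_term" where
  "ghost_path_term v [] = Vertex v"
| "ghost_path_term v (e # p) = Mult (ghost_path_term (head E e) p) (Ghost e)"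

text \<open>A ghost path pulls functions back along the composed injections, where
  \<open>foldr\<close> applies that of the last arc first.\<close>

lemma act_ghost_path_term:
  "awalk u p v \<Longrightarrow> u \<notin> H \<Longrightarrow> \<forall>e\<in>set p. head E e \<notin> H \<Longrightarrow>
    act (ghost_path_term u p) f = (\<lambda>z n. if z = v then f u (foldr \<phi> p n) else 0)"
  by (induction p arbitrary: u f) (auto simp: awalk_simps fun_eq_iff)

end

text \<open>Disjointness and covering depend on the ranges alone, so each injection may be exchanged
  for another one with the same range.\<close>

lemma branching_change_injections:
  assumes "branching E H \<phi>" "\<And>e. inj (\<phi> e) \<Longrightarrow> inj (\<psi> e)" "\<And>e. range (\<psi> e) = range (\<phi> e)"
  shows "branching E H \<psi>"
  using assms(1) unfolding branching_def branching_axioms_def assms(3) using assms(2) by blast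

text \<open>If any arc leads from \<open>v\<close> to a vertex outside \<open>H\<close>, the set of
  pairs of such an arc and a number is countably infinite; an enumeration of it, restricted to one
  arc, is the injection of that arc. Saturation provides such an arc at every finite emitter outside
  \<open>H\<close>.\<close>

lemma branching_exists:
  assumes "wf_digraph E" and count: "countable (arcs E)" and H: "hereditary E H" "saturated E H"
  obtains \<phi> where "branching E H \<phi>"
proof -
  define O' where "O' v = {e \<in> out_arcs E v. head E e \<notin> H}" for v
  define \<phi> where "\<phi> e n = to_nat_on (O' (tail E e) \<times> UNIV) (e, n)" for e and n :: nat
  have bij: "bij_betw (to_nat_on (O' v \<times> (UNIV :: nat set))) (O' v \<times> UNIV) UNIV" if "O' v \<noteq> {}" for v
  proof (rule to_nat_on_infinite)
    have "O' v \<subseteq> arcs E" by (auto simp: O'_def)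
    then show "countable (O' v \<times> (UNIV :: nat set))" using count countable_subset by blast
    show "infinite (O' v \<times> (UNIV :: nat set))" using that by (auto simp: finite_cartesian_product_iff)
  qed
  have O': "e \<in> O' (tail E e)" if "e \<in> arcs E" "head E e \<notin> H" for e
    using that by (auto simp: O'_def)
  have "branching E H \<phi>"
  proof (intro branching.intro branching_axioms.intro)
    show "inj (\<phi> e)" if "e \<in> arcs E" "head E e \<notin> H" for e
    proof (rule injI)
      fix m n assume "\<phi> e m = \<phi> e n"
      then show "m = n"
        using bij[of "tail E e"] O'[OF that] by (auto simp: \<phi>_def bij_betw_def dest: inj_onD)
    qed
    show "range (\<phi> e) \<inter> range (\<phi> f) = {}"
      if ef: "e \<in> arcs E" "f \<in> arcs E" "e \<noteq> f" "tail E e = tail E f" "head E e \<notin> H" "head E f \<notin> H"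
      for e f
    proof -
      have "\<phi> e m \<noteq> \<phi> f n" for m n
        using bij[of "tail E f"] O'[OF ef(1,5)] O'[OF ef(2,6)] ef(3,4)
        by (auto simp: \<phi>_def bij_betw_def dest: inj_onD)
      then show ?thesis by auto
    qed
    show "\<exists>e\<in>out_arcs E v. head E e \<notin> H \<and> n \<in> range (\<phi> e)" if v: "finite_emitter E v" "v \<notin> H" for v n
    proof -
      have "\<not> head E ` out_arcs E v \<subseteq> H" using H(2) v by (auto simp: saturated_def)
      then have "O' v \<noteq> {}" by (auto simp: O'_def)
      then have "n \<in> to_nat_on (O' v \<times> UNIV) ` (O' v \<times> (UNIV :: nat set))"
        using bij by (simp add: bij_betw_def)
      then obtain e m where "e \<in> O' v" "n = to_nat_on (O' v \<times> UNIV) (e, m :: nat)" by auto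
      then have "e \<in> out_arcs E v" "head E e \<notin> H" "n = \<phi> e m" by (auto simp: O'_def \<phi>_def)
      then show ?thesis by blast
    qed
  qed (use assms in auto)
  then show ?thesis using that by blast
qed

lemma hereditary_saturated_empty: "hereditary E {}" "saturated E {}"
  by (auto simp: hereditary_def saturated_def finite_emitter_def)

text \<open>The relations might a priori collapse a vertex; the representation with
  \<open>H = {}\<close> shows that they do not.\<close>

lemma vertex_not_zero:
  assumes "wf_digraph E" "countable (arcs E)" "v \<in> verts E"
  shows "\<not> leavitt_eq E (Vertex v :: ('k::field,'v,'e) leavitt_term) Zero"
proof
  assume eq: "leavitt_eq E (Vertex v :: ('k,'v,'e) leavitt_term) Zero"
  obtain \<phi> where "branching E {} \<phi>"
    using branching_exists[OF assms(1,2) hereditary_saturated_empty] .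
  then interpret branching E "{}" \<phi> .
  show False using fun_cong[OF fun_cong[OF act_respects[OF eq, of "\<lambda>_ _. 1"]], of v 0] assms(3) by simp
qed

lemma leavitt_path_algebra_leavitt_algebra:
  fixes E :: "('v,'e) pre_digraph"
  assumes "wf_digraph E" "countable (arcs E)"
  shows "leavitt_algebra (leavitt_path_algebra TYPE('k::field) E) E (\<lambda>v. leavitt_class E (Vertex v))
    (\<lambda>e. leavitt_class E (Edge e)) (\<lambda>e. leavitt_class E (Ghost e))"
proof -
  let ?L = "leavitt_path_algebra TYPE('k) E"
  interpret L: nonunital_algebra ?L by (rule leavitt_path_algebra_is_algebra)
  show ?thesis
  proof (intro leavitt_algebra.intro leavitt_algebra_axioms.intro)
    show "leavitt_class E (Vertex v) \<noteq> \<zero>\<^bsub>?L\<^esub>" if "v \<in> verts E" for v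
      using vertex_not_zero[OF assms that] by (simp add: zero_L leavitt_class_eq_iff)
    fix S assume gen: "(\<lambda>v. leavitt_class E (Vertex v)) ` verts E \<subseteq> S"
      "(\<lambda>e. leavitt_class E (Edge e)) ` arcs E \<subseteq> S" "(\<lambda>e. leavitt_class E (Ghost e)) ` arcs E \<subseteq> S"
      and zero: "\<zero>\<^bsub>?L\<^esub> \<in> S" and add: "\<And>x y. x \<in> S \<Longrightarrow> y \<in> S \<Longrightarrow> x \<oplus>\<^bsub>?L\<^esub> y \<in> S"
      and mult: "\<And>x y. x \<in> S \<Longrightarrow> y \<in> S \<Longrightarrow> x \<otimes>\<^bsub>?L\<^esub> y \<in> S"
      and smult: "\<And>c x. x \<in> S \<Longrightarrow> c \<odot>\<^bsub>?L\<^esub> x \<in> S"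
    have junk: "leavitt_class E t \<in> S" if "leavitt_eq E t Zero" for t :: "('k,'v,'e) leavitt_term"
      using that zero unfolding zero_L by (metis leavitt_class_eq_iff)
    have "leavitt_class E t \<in> S" for t :: "('k,'v,'e) leavitt_term"
    proof (induction t)
      case (Vertex v)
      then show ?case using gen(1) junk[OF leavitt_eq.no_vertex] by (cases "v \<in> verts E") auto
    next
      case (Edge e)
      then show ?case using gen(2) junk[OF leavitt_eq.no_edge] by (cases "e \<in> arcs E") auto
    next
      case (Ghost e)
      then show ?case using gen(3) junk[OF leavitt_eq.no_ghost] by (cases "e \<in> arcs E") auto
    next
      case (Neg t)
      \<comment> \<open>Negation is reached through scaling by -1, as \<open>S\<close> is assumed
        closed under scaling only.\<close>
      have "leavitt_class E (Neg t) = \<ominus>\<^bsub>?L\<^esub> leavitt_class E t"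
        by (rule L.minus_equality[symmetric])
          (auto simp: add_L zero_L carrier_L leavitt_class_eq_iff intro: leavitt_eq.add_neg)
      also have "\<dots> = (- 1) \<odot>\<^bsub>?L\<^esub> leavitt_class E t"
        by (rule L.minus_one_smult[symmetric]) (simp add: carrier_L)
      finally show ?case using smult[OF Neg] by simp
    next
      case Zero
      then show ?case using zero by (simp add: zero_L)
    qed (use add mult smult in \<open>simp_all flip: add_L mult_L smult_L\<close>)
    then show "carrier ?L \<subseteq> S" by (auto simp: carrier_L)
  qed (use assms leavitt_path_algebra_family leavitt_path_algebra_is_algebra in auto)
qed

section \<open>The characterisation\<close>

text \<open>In the representation over the complement of \<open>H\<close>, a vertex of
  \<open>H\<close> acts as zero although it is nonzero in the algebra, while a vertex outside
  \<open>H\<close> acts nontrivially.\<close>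

lemma simple_imp_trivial_hereditary_saturated:
  fixes E :: "('v,'e) pre_digraph"
  assumes E: "wf_digraph E" "countable (arcs E)"
    and simple: "simple_ring (leavitt_path_algebra TYPE('k::field) E)"
    and H: "H \<subseteq> verts E" "hereditary E H" "saturated E H"
  shows "H = {} \<or> H = verts E"
proof (rule ccontr)
  assume "\<not> (H = {} \<or> H = verts E)"
  then obtain v w where vw: "v \<in> H" "w \<in> verts E" "w \<notin> H" using H(1) by blast
  obtain \<phi> where "branching E H \<phi>" using branching_exists[OF E H(2,3)] .
  then interpret branching E H \<phi> .
  have nonzero: "\<not> leavitt_eq E (Vertex v :: ('k,'v,'e) leavitt_term) Zero"
    using vertex_not_zero[OF E] vw(1) H(1) by blast
  have zero: "act (Vertex v :: ('k,'v,'e) leavitt_term) f = (\<lambda>u n. 0)" for f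
    using vw(1) by auto
  have "act (Vertex w :: ('k,'v,'e) leavitt_term) (\<lambda>_ _. 1) = (\<lambda>u n. 0)"
    by (rule act_eq_zero_if_simple[OF simple zero nonzero])
  from fun_cong[OF fun_cong[OF this], of w 0] show False using vw by simp
qed

text \<open>On a closed path \<open>p\<close> without exit the injections may be chosen freely: the identity makes
  \<open>p\<^sup>*\<close> act as its base vertex, a transposition on the first arc does not.\<close>

lemma simple_imp_condition_L:
  fixes E :: "('v,'e) pre_digraph"
  assumes E: "wf_digraph E" "countable (arcs E)"
    and simple: "simple_ring (leavitt_path_algebra TYPE('k::field) E)"
  shows "condition_L E"
  unfolding condition_L_def
proof (intro allI impI, rule ccontr)
  fix p assume p: "simple_closed_path E p" and no_exit: "\<not> has_exit E p"
  interpret wf_digraph E by (rule E)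
  obtain u where u: "awalk u p u" "p \<noteq> []" "distinct (map (tail E) p)"
    using p by (auto simp: simple_closed_path_def closed_w_def)
  obtain e0 r where er: "p = e0 # r" using u(2) by (cases p) auto
  obtain \<phi> where \<phi>: "branching E {} \<phi>" using branching_exists[OF E hereditary_saturated_empty] .
  interpret \<phi>: branching E "{}" \<phi> by (rule \<phi>)
  \<comment> \<open>Without an exit \<open>e\<close> is the only arc at its tail, so the covering
    condition makes \<open>\<phi> e\<close> surjective.\<close>
  have onto: "range (\<phi> e) = UNIV" if e: "e \<in> set p" for e
  proof -
    have "e \<in> arcs E" using u(1) e by auto
    then have "out_arcs E (tail E e) = {e}" using no_exit e by (auto simp: has_exit_def)
    moreover from this \<open>e \<in> arcs E\<close> have "finite_emitter E (tail E e)" by (simp add: finite_emitter_def)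
    ultimately show ?thesis using \<phi>.cover[of "tail E e"] by auto
  qed
  define \<psi> where "\<psi> e = (if e \<in> set p then id else \<phi> e)" for e
  define \<sigma> :: "nat \<Rightarrow> nat" where "\<sigma> n = (if n = 0 then 1 else if n = 1 then 0 else n)" for n
  have \<sigma>\<sigma>: "\<sigma> (\<sigma> n) = n" for n by (simp add: \<sigma>_def)
  then have \<sigma>: "inj \<sigma>" "range \<sigma> = UNIV" using inj_on_inverseI[of UNIV \<sigma> \<sigma>] surjI[of \<sigma> \<sigma>] by simp_all
  define \<chi> where "\<chi> = \<psi>(e0 := \<sigma>)"
  have "branching E {} \<psi>"
    using \<phi> by (rule branching_change_injections) (auto simp: \<psi>_def onto)
  interpret \<psi>: branching E "{}" \<psi> by fact
  have "branching E {} \<chi>"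
    using \<phi> by (rule branching_change_injections) (auto simp: \<chi>_def \<psi>_def onto \<sigma> er)
  interpret \<chi>: branching E "{}" \<chi> by fact
  have \<psi>_path: "foldr \<psi> q n = n" if "set q \<subseteq> set p" for q n
    using that by (induction q) (auto simp: \<psi>_def)
  \<comment> \<open>Distinct tails keep \<open>e0\<close> out of \<open>r\<close>, so the
    transposition is met exactly once around \<open>p\<close>.\<close>
  have "e0 \<notin> set r" using u(3) er by auto
  then have "foldr \<chi> r n = foldr \<psi> r n" for n
    by (intro foldr_cong) (auto simp: \<chi>_def)
  then have \<chi>_path: "foldr \<chi> p n = \<sigma> n" for n
    using \<psi>_path[of r n] by (simp add: er \<chi>_def set_subset_Cons subset_insertI)
  \<comment> \<open>\<open>t\<close> stands for \<open>p^* - u\<close>. It acts as zero through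
    \<open>\<psi>\<close>, but through \<open>\<chi>\<close> it compares a function at
    \<open>\<sigma> n\<close> and at \<open>n\<close>, so it is a nonzero element of the first
    kernel.\<close>
  define t :: "('k,'v,'e) leavitt_term" where "t = Add (\<psi>.ghost_path_term u p) (Neg (Vertex u))"
  have uv: "u \<in> verts E" using u(1) by (simp add: awalk_hd_in_verts)
  have "\<psi>.act t f = (\<lambda>u n. 0)" for f
    using uv by (auto simp: t_def \<psi>.act_ghost_path_term[OF u(1)] \<psi>_path fun_eq_iff)
  moreover have "\<not> leavitt_eq E t Zero"
  proof
    assume "leavitt_eq E t Zero"
    from \<chi>.act_respects[OF this, of "\<lambda>_ n. if n = 0 then 0 else 1"]
    have "\<chi>.act t (\<lambda>_ n. if n = 0 then 0 else 1) u 0 = 0" by simp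
    then show False using uv
      by (simp add: t_def \<chi>.act_ghost_path_term[OF u(1)] \<chi>_path \<sigma>_def)
  qed
  ultimately have "\<psi>.act (Vertex u :: ('k,'v,'e) leavitt_term) (\<lambda>_ _. 1) = (\<lambda>u n. 0)"
    by (rule \<psi>.act_eq_zero_if_simple[OF simple])
  from fun_cong[OF fun_cong[OF this], of u 0] show False using uv by simp
qed

text \<open>Simplicity supplies a nonzero element, as the zero algebra is purely infinite for want
  of nonzero right ideals. The whole algebra is then a nonzero right ideal, and an infinite
  idempotent in it contradicts the acyclic case.\<close>

lemma purely_infinite_imp_closed_path:
  fixes E :: "('v,'e) pre_digraph"
  assumes E: "wf_digraph E" "countable (arcs E)"
    and pis: "purely_infinite_simple (leavitt_path_algebra TYPE('k::field) E)"
  shows "\<exists>p. wf_digraph.closed_w E p"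
proof (rule ccontr)
  assume acyclic: "\<nexists>p. wf_digraph.closed_w E p"
  let ?L = "leavitt_path_algebra TYPE('k) E"
  interpret leavitt_algebra ?L E "\<lambda>v. leavitt_class E (Vertex v)" "\<lambda>e. leavitt_class E (Edge e)"
      "\<lambda>e. leavitt_class E (Ghost e)"
    by (rule leavitt_path_algebra_leavitt_algebra[OF E])
  obtain x y where "x \<in> carrier ?L" "y \<in> carrier ?L" "x \<otimes>\<^bsub>?L\<^esub> y \<noteq> \<zero>\<^bsub>?L\<^esub>"
    using pis by (auto simp: purely_infinite_simple_def simple_ring_def)
  then have "carrier ?L \<noteq> {\<zero>\<^bsub>?L\<^esub>}" using m_closed by blast
  moreover have "right_ideal ?L (carrier ?L)"
    by (auto simp: right_ideal_def m_closed intro!: additive_subgroup.intro add.subgroup_self)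
  ultimately obtain a where "infinite_idempotent ?L a"
    using pis by (auto simp: purely_infinite_simple_def purely_infinite_def)
  then show False using acyclic_no_infinite_idempotent[OF acyclic] by blast
qed

lemma conditions_imp_purely_infinite_simple:
  fixes E :: "('v,'e) pre_digraph"
  assumes E: "wf_digraph E" "countable (arcs E)"
    and trivial: "\<And>S. S \<subseteq> verts E \<Longrightarrow> hereditary E S \<Longrightarrow> saturated E S \<Longrightarrow> S = {} \<or> S = verts E"
    and cw: "wf_digraph.closed_w E p" and L: "condition_L E"
  shows "purely_infinite_simple (leavitt_path_algebra TYPE('k::field) E)"
proof -
  let ?L = "leavitt_path_algebra TYPE('k) E"
  interpret leavitt_algebra ?L E "\<lambda>v. leavitt_class E (Vertex v)" "\<lambda>e. leavitt_class E (Edge e)"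
      "\<lambda>e. leavitt_class E (Ghost e)"
    by (rule leavitt_path_algebra_leavitt_algebra[OF E])
  obtain w c where c: "awalk w c w" "c \<noteq> []" "distinct (map (tail E) c)" "simple_closed_path E c"
    using simple_closed_path_exists[OF cw] .
  obtain e f where ef: "e \<in> set c" "f \<in> out_arcs E (tail E e)" "f \<noteq> e"
    using L c(4) by (auto simp: condition_L_def has_exit_def)
  obtain q r where qr: "c = q @ e # r" using ef(1) by (meson split_list)
  have q: "awalk w q (tail E e)" using c(1) unfolding qr by (auto simp: awalk_simps)
  have reach: "\<exists>p. awalk v p w" if "v \<in> verts E" for v
    using reaches_closed_path[OF trivial c(1,2) that] by blast
  obtain g where "awalk (head E f) g w" using reach[of "head E f"] ef(2) by auto
  \<comment> \<open>The second closed path follows \<open>c\<close> along \<open>q\<close>, leaves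
    it through the exit \<open>f\<close> in place of \<open>e\<close>, and returns by
    \<open>g\<close>; after \<open>q\<close> the two disagree, hence neither is a prefix of the
    other.\<close>
  then have d: "awalk w (q @ f # g) w"
    using ef(2) by (intro awalk_appendI[OF q]) (auto simp: awalk_simps)
  interpret leavitt_two_loops ?L E "\<lambda>v. leavitt_class E (Vertex v)" "\<lambda>e. leavitt_class E (Edge e)"
      "\<lambda>e. leavitt_class E (Ghost e)" w c "q @ f # g"
    by unfold_locales (use c d reach ef(3) in \<open>auto simp: qr simp del: awalk_append_iff\<close>)
  show ?thesis
    using purely_infinite simple_ring[OF trivial] by (simp add: purely_infinite_simple_def)
qed

theorem theorem3p1:
  fixes E :: "('v,'e) pre_digraph"
  assumes "wf_digraph E" and "countable (verts E)" and "countable (arcs E)"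
  shows "purely_infinite_simple (leavitt_path_algebra TYPE('k::field) E) \<longleftrightarrow>
    (\<forall>X. X \<subseteq> verts E \<and> hereditary E X \<and> saturated E X \<longrightarrow> X = {} \<or> X = verts E) \<and>
    (\<exists>p. wf_digraph.closed_w E p) \<and>
    condition_L E" (is "?pis \<longleftrightarrow> ?conditions")
proof
  assume pis: ?pis
  then have simple: "simple_ring (leavitt_path_algebra TYPE('k::field) E)"
    by (simp add: purely_infinite_simple_def)
  show ?conditions
    using simple_imp_trivial_hereditary_saturated[OF assms(1,3) simple]
      simple_imp_condition_L[OF assms(1,3) simple] purely_infinite_imp_closed_path[OF assms(1,3) pis]
    by simp
next
  assume ?conditions
  then show ?pis using conditions_imp_purely_infinite_simple[OF assms(1,3)] by metis
qed

end
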